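(* Let $\Gamma$ be a Gromov hyperbolic Coxeter group and let $F\subset\partial\Gamma$ be a subset containing at least two distinct points. Assume $F$ is invariant under each reflection whose wall cuts $F$, and let $P$ be the subgroup of $\Gamma$ generated by these reflections. Then $P$ is a parabolic subgroup of $\Gamma$, the closure of $F$ equals the limit set $\partial P$, and $P$ is the stabilizer of $F$ in $\Gamma$.
   Context: $(\Gamma,S)$ is a Coxeter system: presentation $\langle s\in S\mid s^2=1,\ (ss')^{m_{ss'}}=1 \text{ for } s\neq s'\rangle$, $S$ finite, $m_{ss'}\in\{2,\dots,\infty\}$; parabolic subgroups are conjugates of subgroups generated by nonempty subsets of $S$. Let $G$ be the Cayley graph of $(\Gamma,S)$. For $s\in S$, the wall $M_s$ is the set of open edges of $G$ that are invariant under (left multiplication by) $s$. A wall is a set $g(M_s)$, $g\in\Gamma$, $s\in S$; the reflection along $g(M_s)$ is $gsg^{-1}$. The complement $G\setminus M$ of a wall consists of two convex closed subsets, the half-spaces $H_-(M)\ni e$ and $H_+(M)$. $\partial\Gamma$ is the Gromov boundary, and for $E\subset G$, $\partial E$ is its limit set in $\partial\Gamma$. A wall $M$ cuts $F\subset\partial\Gamma$ if $F$ meets both $\partial H_-(M)$ and $\partial H_+(M)$. Reflections act on $\partial\Gamma$ via the boundary action of $\Gamma$. *)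

theory Defs
  imports "HOL-Analysis.Analysis" "HOL-Algebra.Coset" "HOL-Algebra.Generated_Groups"
begin

definition word_eval :: "('g, 'b) monoid_scheme \<Rightarrow> 'g list \<Rightarrow> 'g" where
  "word_eval G w = foldr (\<lambda>s x. s \<otimes>\<^bsub>G\<^esub> x) w \<one>\<^bsub>G\<^esub>"

definition cox_relators :: "'g set \<Rightarrow> ('g \<Rightarrow> 'g \<Rightarrow> enat) \<Rightarrow> 'g list set" where
  "cox_relators S m =
     {[s, s] | s. s \<in> S} \<union>
     {concat (replicate k [s, s']) | s s' k. s \<in> S \<and> s' \<in> S \<and> s \<noteq> s' \<and> m s s' = enat k}"

text \<open>The congruence on words generated by the relators (words over S; since all
  generators are involutions, the presented group is the quotient monoid).\<close>
inductive cox_equiv :: "'g set \<Rightarrow> ('g \<Rightarrow> 'g \<Rightarrow> enat) \<Rightarrow> 'g list \<Rightarrow> 'g list \<Rightarrow> bool"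
  for S m where
  refl: "cox_equiv S m w w"
| sym: "cox_equiv S m u v \<Longrightarrow> cox_equiv S m v u"
| trans: "cox_equiv S m u v \<Longrightarrow> cox_equiv S m v w \<Longrightarrow> cox_equiv S m u w"
| del: "r \<in> cox_relators S m \<Longrightarrow> cox_equiv S m (u @ r @ v) (u @ v)"

definition coxeter_system :: "('g, 'b) monoid_scheme \<Rightarrow> 'g set \<Rightarrow> bool" where
  "coxeter_system G S \<longleftrightarrow> group G \<and> S \<subseteq> carrier G \<and> finite S \<and>
     (\<exists>m :: 'g \<Rightarrow> 'g \<Rightarrow> enat.
        (\<forall>s\<in>S. \<forall>s'\<in>S. m s s' = m s' s) \<and>
        (\<forall>s\<in>S. \<forall>s'\<in>S. s \<noteq> s' \<longrightarrow> m s s' \<ge> 2) \<and>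
        carrier G = word_eval G ` lists S \<and>
        (\<forall>u\<in>lists S. \<forall>v\<in>lists S. word_eval G u = word_eval G v \<longleftrightarrow> cox_equiv S m u v))"

definition cayley_edges :: "('g, 'b) monoid_scheme \<Rightarrow> 'g set \<Rightarrow> 'g set set" where
  "cayley_edges G S = {{x, x \<otimes>\<^bsub>G\<^esub> s} | x s. x \<in> carrier G \<and> s \<in> S}"

definition lmult :: "('g, 'b) monoid_scheme \<Rightarrow> 'g \<Rightarrow> 'g \<Rightarrow> 'g" where
  "lmult G g x = g \<otimes>\<^bsub>G\<^esub> x"

definition wall_gen :: "('g, 'b) monoid_scheme \<Rightarrow> 'g set \<Rightarrow> 'g \<Rightarrow> 'g set set" where
  "wall_gen G S s = {e \<in> cayley_edges G S. lmult G s ` e = e}"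

definition wall :: "('g, 'b) monoid_scheme \<Rightarrow> 'g set \<Rightarrow> 'g \<Rightarrow> 'g \<Rightarrow> 'g set set" where
  "wall G S g s = (\<lambda>e. lmult G g ` e) ` wall_gen G S s"

definition reflection :: "('g, 'b) monoid_scheme \<Rightarrow> 'g \<Rightarrow> 'g \<Rightarrow> 'g" where
  "reflection G g s = g \<otimes>\<^bsub>G\<^esub> s \<otimes>\<^bsub>G\<^esub> inv\<^bsub>G\<^esub> g"

text \<open>Vertex set of the half-space H_-(M): the connected component of the identity
  in the Cayley graph with the (open) edges of M removed.  H_+(M) is the other
  component, i.e. the remaining vertices.  (Limit sets only depend on vertices.)\<close>
definition half_minus :: "('g, 'b) monoid_scheme \<Rightarrow> 'g set \<Rightarrow> 'g set set \<Rightarrow> 'g set" where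
  "half_minus G S M =
     {y \<in> carrier G. (\<one>\<^bsub>G\<^esub>, y) \<in> {(x, z). {x, z} \<in> cayley_edges G S - M}\<^sup>*}"

definition half_plus :: "('g, 'b) monoid_scheme \<Rightarrow> 'g set \<Rightarrow> 'g set set \<Rightarrow> 'g set" where
  "half_plus G S M = carrier G - half_minus G S M"

definition word_dist :: "('g, 'b) monoid_scheme \<Rightarrow> 'g set \<Rightarrow> 'g \<Rightarrow> 'g \<Rightarrow> nat" where
  "word_dist G S x y = (LEAST n. \<exists>w \<in> lists S. length w = n \<and> x \<otimes>\<^bsub>G\<^esub> word_eval G w = y)"

definition gromov_prod :: "('g, 'b) monoid_scheme \<Rightarrow> 'g set \<Rightarrow> 'g \<Rightarrow> 'g \<Rightarrow> 'g \<Rightarrow> real" where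
  "gromov_prod G S w x y =
     (real (word_dist G S w x) + real (word_dist G S w y) - real (word_dist G S x y)) / 2"

definition gromov_hyperbolic :: "('g, 'b) monoid_scheme \<Rightarrow> 'g set \<Rightarrow> bool" where
  "gromov_hyperbolic G S \<longleftrightarrow> (\<exists>\<delta>\<ge>0. \<forall>w\<in>carrier G. \<forall>x\<in>carrier G. \<forall>y\<in>carrier G. \<forall>z\<in>carrier G.
      gromov_prod G S w x z \<ge> min (gromov_prod G S w x y) (gromov_prod G S w y z) - \<delta>)"

definition conv_infty :: "('g, 'b) monoid_scheme \<Rightarrow> 'g set \<Rightarrow> (nat \<Rightarrow> 'g) \<Rightarrow> bool" where
  "conv_infty G S x \<longleftrightarrow> (\<forall>i. x i \<in> carrier G) \<and>
     filterlim (\<lambda>(i, j). gromov_prod G S \<one>\<^bsub>G\<^esub> (x i) (x j)) at_top (sequentially \<times>\<^sub>F sequentially)"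

definition seq_equiv :: "('g, 'b) monoid_scheme \<Rightarrow> 'g set \<Rightarrow> (nat \<Rightarrow> 'g) \<Rightarrow> (nat \<Rightarrow> 'g) \<Rightarrow> bool" where
  "seq_equiv G S x y \<longleftrightarrow> filterlim (\<lambda>i. gromov_prod G S \<one>\<^bsub>G\<^esub> (x i) (y i)) at_top sequentially"

definition bclass :: "('g, 'b) monoid_scheme \<Rightarrow> 'g set \<Rightarrow> (nat \<Rightarrow> 'g) \<Rightarrow> (nat \<Rightarrow> 'g) set" where
  "bclass G S x = {y. conv_infty G S y \<and> seq_equiv G S x y}"

definition gromov_boundary :: "('g, 'b) monoid_scheme \<Rightarrow> 'g set \<Rightarrow> (nat \<Rightarrow> 'g) set set" where
  "gromov_boundary G S = {bclass G S x | x. conv_infty G S x}"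

definition limit_set :: "('g, 'b) monoid_scheme \<Rightarrow> 'g set \<Rightarrow> 'g set \<Rightarrow> (nat \<Rightarrow> 'g) set set" where
  "limit_set G S E = {\<xi> \<in> gromov_boundary G S. \<exists>x\<in>\<xi>. \<forall>i. x i \<in> E}"

definition bgromov_prod :: "('g, 'b) monoid_scheme \<Rightarrow> 'g set \<Rightarrow> (nat \<Rightarrow> 'g) set \<Rightarrow> (nat \<Rightarrow> 'g) set \<Rightarrow> ereal" where
  "bgromov_prod G S \<xi> \<eta> = (SUP x\<in>\<xi>. SUP y\<in>\<eta>.
      Liminf (sequentially \<times>\<^sub>F sequentially) (\<lambda>(i, j). ereal (gromov_prod G S \<one>\<^bsub>G\<^esub> (x i) (y j))))"

text \<open>Standard topology on the boundary: the sets {\<eta>. (\<xi>|\<eta>) > r} form a neighbourhood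
  basis of \<xi>.\<close>
definition boundary_topology :: "('g, 'b) monoid_scheme \<Rightarrow> 'g set \<Rightarrow> (nat \<Rightarrow> 'g) set topology" where
  "boundary_topology G S = topology (\<lambda>U. U \<subseteq> gromov_boundary G S \<and>
      (\<forall>\<xi>\<in>U. \<exists>r::real. {\<eta> \<in> gromov_boundary G S. bgromov_prod G S \<xi> \<eta> > ereal r} \<subseteq> U))"

definition bact :: "('g, 'b) monoid_scheme \<Rightarrow> 'g \<Rightarrow> (nat \<Rightarrow> 'g) set \<Rightarrow> (nat \<Rightarrow> 'g) set" where
  "bact G g \<xi> = (\<lambda>x. \<lambda>i. g \<otimes>\<^bsub>G\<^esub> x i) ` \<xi>"

definition cuts :: "('g, 'b) monoid_scheme \<Rightarrow> 'g set \<Rightarrow> 'g set set \<Rightarrow> (nat \<Rightarrow> 'g) set set \<Rightarrow> bool" where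
  "cuts G S M F \<longleftrightarrow> F \<inter> limit_set G S (half_minus G S M) \<noteq> {} \<and>
                     F \<inter> limit_set G S (half_plus G S M) \<noteq> {}"

definition parabolic_subgroup :: "('g, 'b) monoid_scheme \<Rightarrow> 'g set \<Rightarrow> 'g set \<Rightarrow> bool" where
  "parabolic_subgroup G S P \<longleftrightarrow> (\<exists>g\<in>carrier G. \<exists>T. T \<subseteq> S \<and> T \<noteq> {} \<and>
      P = (g <#\<^bsub>G\<^esub> generate G T) #>\<^bsub>G\<^esub> inv\<^bsub>G\<^esub> g)"

definition boundary_stabilizer :: "('g, 'b) monoid_scheme \<Rightarrow> (nat \<Rightarrow> 'g) set set \<Rightarrow> 'g set" where
  "boundary_stabilizer G F = {g \<in> carrier G. bact G g ` F = F}"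

end

theory Submission
  imports Defs
begin

text \<open>Call a wall cutting if it cuts \<open>F\<close>, and let \<open>C\<close> be the intersection of the half-spaces
  bounded by non-cutting walls on the side of \<open>F\<close>. If \<open>x\<^sub>i\<close> and \<open>y\<^sub>i\<close> converge to distinct points
  of \<open>F\<close>, the geodesics from \<open>x\<^sub>i\<close> to \<open>y\<^sub>i\<close> all meet one ball, and a point lying on infinitely
  many of them lies in \<open>C\<close>; so \<open>C\<close> is not empty. The stabilizer of \<open>F\<close> preserves \<open>C\<close> and acts
  freely, while \<open>P\<close> is transitive on \<open>C\<close>: since \<open>C\<close> is convex, two of its points are joined
  inside \<open>C\<close>, and an edge in \<open>C\<close> crosses a cutting wall. Hence \<open>P\<close> is the stabilizer,
  \<open>C = Pz = zW\<^sub>T\<close> and \<open>P = zW\<^sub>Tz\<inverse>\<close>, where \<open>T\<close> consists of the \<open>s\<close> with \<open>zs \<in> C\<close>.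
  Geodesics from \<open>z\<close> towards a point of \<open>F\<close> stay in \<open>C\<close>, so \<open>F\<close> lies in the closed set
  \<open>\<partial>P\<close>; conversely, if \<open>p\<^sub>n \<in> P\<close> tends to \<open>\<xi>\<close> and \<open>\<alpha>, \<beta>\<close> are distinct points of \<open>F\<close>, then one
  of \<open>p\<^sub>n\<alpha>\<close>, \<open>p\<^sub>n\<beta>\<close> is close to \<open>\<xi>\<close>.\<close>

section \<open>Words in the generators and their evaluation\<close>

locale coxeter_group = group G for G :: "('g, 'b) monoid_scheme" (structure) +
  fixes S :: "'g set" and m :: "'g \<Rightarrow> 'g \<Rightarrow> enat"
  assumes S_sub: "S \<subseteq> carrier G"
    and finite_S: "finite S"
    and generated: "carrier G = word_eval G ` lists S"
    and presented: "\<And>u v. u \<in> lists S \<Longrightarrow> v \<in> lists S \<Longrightarrow>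
      word_eval G u = word_eval G v \<longleftrightarrow> cox_equiv S m u v"
begin

abbreviation ev :: "'g list \<Rightarrow> 'g" where "ev \<equiv> word_eval G"
abbreviation dist :: "'g \<Rightarrow> 'g \<Rightarrow> nat" where "dist \<equiv> word_dist G S"
abbreviation conj_by :: "'g \<Rightarrow> 'g \<Rightarrow> 'g" where "conj_by \<equiv> reflection G"

lemma S_carrier [simp]: "s \<in> S \<Longrightarrow> s \<in> carrier G"
  using S_sub by blast

lemma ev_Nil [simp]: "ev [] = \<one>"
  by (simp add: word_eval_def)

lemma ev_Cons [simp]: "ev (s # w) = s \<otimes> ev w"
  by (simp add: word_eval_def)

lemma ev_carrier [simp]: "w \<in> lists S \<Longrightarrow> ev w \<in> carrier G"
  by (induction w) auto

lemma ev_append [simp]: "u \<in> lists S \<Longrightarrow> v \<in> lists S \<Longrightarrow> ev (u @ v) = ev u \<otimes> ev v"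
  by (induction u) (auto simp: m_assoc)

lemma conj_by_closed [simp]: "g \<in> carrier G \<Longrightarrow> x \<in> carrier G \<Longrightarrow> conj_by g x \<in> carrier G"
  by (simp add: reflection_def)

lemma relator_lists: "r \<in> cox_relators S m \<Longrightarrow> r \<in> lists S"
  by (auto simp: cox_relators_def in_lists_conv_set split: if_splits)

lemma cox_equiv_Nil_relator: "r \<in> cox_relators S m \<Longrightarrow> cox_equiv S m r []"
  using cox_equiv.del[of r S m "[]" "[]"] by simp

lemma ev_relator: "r \<in> cox_relators S m \<Longrightarrow> ev r = \<one>"
  using presented[of r "[]"] cox_equiv_Nil_relator relator_lists by simp

lemma S_square [simp]: "s \<in> S \<Longrightarrow> s \<otimes> s = \<one>"
  using ev_relator[of "[s, s]"] by (simp add: cox_relators_def)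

lemma S_square' [simp]: "s \<in> S \<Longrightarrow> x \<in> carrier G \<Longrightarrow> s \<otimes> (s \<otimes> x) = x"
  by (simp flip: m_assoc)

lemma inv_S [simp]: "s \<in> S \<Longrightarrow> inv s = s"
  by (simp add: inv_equality)

text \<open>Every relator has even length, so inserting or deleting one keeps the parity. This is
  what prevents a generator from being trivial in \<open>S_not_one\<close>.\<close>

lemma cox_equiv_even_length:
  "cox_equiv S m u v \<Longrightarrow> even (length u) = even (length v)"
  by (induction rule: cox_equiv.induct)
    (auto simp: cox_relators_def length_concat sum_list_replicate)

lemma S_not_one: "s \<in> S \<Longrightarrow> s \<noteq> \<one>"
proof
  assume s: "s \<in> S" "s = \<one>"
  then have "ev [s] = ev []" by simp
  then have "cox_equiv S m [s] []" using presented s(1) by (metis Cons_in_lists_iff lists.Nil)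
  from cox_equiv_even_length[OF this] show False by simp
qed

subsection \<open>Crossing parity\<close>

text \<open>Left multiplication by \<open>conj_by p s\<close> exchanges \<open>p\<close> and
  \<open>p \<otimes> s\<close>, so each entry names the wall of one edge on the path that starts at
  \<open>p\<close> and reads \<open>w\<close>. Walls are encoded by their reflections
  throughout.\<close>

fun crossings :: "'g \<Rightarrow> 'g list \<Rightarrow> 'g list" where
  "crossings p [] = []"
| "crossings p (s # w) = conj_by p s # crossings (p \<otimes> s) w"

lemma crossings_append:
  "p \<in> carrier G \<Longrightarrow> u \<in> lists S \<Longrightarrow> crossings p (u @ v) = crossings p u @ crossings (p \<otimes> ev u) v"
  by (induction u arbitrary: p) (auto simp: m_assoc)

text \<open>In the dihedral group of \<open>s\<close> and \<open>s'\<close>, conjugation by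
  \<open>s\<close> inverts the rotation \<open>s \<otimes> s'\<close>.\<close>

lemma dihedral_conj:
  assumes "s \<in> S" "s' \<in> S"
  shows "s \<otimes> inv ((s \<otimes> s') [^] (k::nat)) = (s \<otimes> s') [^] k \<otimes> s"
proof (induction k)
  case (Suc k)
  have c [simp]: "s \<in> carrier G" "s' \<in> carrier G" "(s \<otimes> s') [^] k \<in> carrier G"
    using assms by auto
  have "s \<otimes> inv ((s \<otimes> s') [^] Suc k) = s \<otimes> (inv (s \<otimes> s') \<otimes> inv ((s \<otimes> s') [^] k))"
    by (simp add: inv_mult_group)
  also have "\<dots> = s \<otimes> s' \<otimes> (s \<otimes> inv ((s \<otimes> s') [^] k))"
    using assms by (simp add: inv_mult_group m_assoc)
  also have "\<dots> = s \<otimes> s' \<otimes> (s \<otimes> s') [^] k \<otimes> s"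
    using Suc.IH by (simp add: m_assoc)
  also have "\<dots> = (s \<otimes> s') [^] Suc k \<otimes> s"
    by (subst nat_pow_Suc2) auto
  finally show ?case .
qed (use assms in auto)

lemma ev_alternating:
  assumes "s \<in> S" "s' \<in> S"
  shows "ev (concat (replicate k [s, s'])) = (s \<otimes> s') [^] k"
proof (induction k)
  case (Suc k)
  then show ?case using assms
    by (subst nat_pow_Suc2) (auto simp: m_assoc)
qed auto

text \<open>The closed form makes it visible that the walls met on a dihedral path repeat as soon as
  a power of \<open>s \<otimes> s'\<close> is trivial.\<close>

lemma crossings_alternating:
  assumes "s \<in> S" "s' \<in> S" "p \<in> carrier G"
  shows "crossings p (concat (replicate k [s, s'])) =
    map (\<lambda>i. conj_by p ((s \<otimes> s') [^] i \<otimes> s)) [0..<2 * k]"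
proof (induction k)
  case (Suc k)
  define a where "a = (s \<otimes> s') [^] k"
  have c [simp]: "s \<in> carrier G" "s' \<in> carrier G" "a \<in> carrier G" "p \<in> carrier G"
    using assms by (auto simp: a_def)
  have sa: "s \<otimes> inv a = a \<otimes> s" using dihedral_conj[OF assms(1,2)] by (simp add: a_def)
  have w: "concat (replicate (Suc k) [s, s']) = concat (replicate k [s, s']) @ [s, s']"
    by (metis append_Nil2 concat.simps(2) concat_append replicate_Suc replicate_append_same concat.simps(1))
  have l: "concat (replicate k [s, s']) \<in> lists S"
    using assms by (auto split: if_splits)
  have comm: "s \<otimes> s' \<otimes> a = a \<otimes> (s \<otimes> s')"
    unfolding a_def using nat_pow_Suc2[of "s \<otimes> s'" k] by simp
  have aa: "(s \<otimes> s') [^] (2 * k) = a \<otimes> a"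
    unfolding a_def mult_2 by (simp add: nat_pow_mult)
  have "conj_by (p \<otimes> a) s = p \<otimes> (a \<otimes> (s \<otimes> inv a)) \<otimes> inv p"
    by (simp add: reflection_def inv_mult_group m_assoc)
  also have "\<dots> = conj_by p ((s \<otimes> s') [^] (2 * k) \<otimes> s)"
    unfolding sa aa by (simp add: reflection_def m_assoc)
  finally have 1: "conj_by (p \<otimes> a) s = conj_by p ((s \<otimes> s') [^] (2 * k) \<otimes> s)" .
  have "conj_by (p \<otimes> a \<otimes> s) s' = p \<otimes> (a \<otimes> (s \<otimes> s') \<otimes> (s \<otimes> inv a)) \<otimes> inv p"
    using assms by (simp add: reflection_def inv_mult_group m_assoc)
  also have "\<dots> = p \<otimes> (a \<otimes> (s \<otimes> s' \<otimes> a) \<otimes> s) \<otimes> inv p"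
    unfolding sa by (simp add: m_assoc)
  also have "\<dots> = conj_by p ((s \<otimes> s') [^] Suc (2 * k) \<otimes> s)"
    unfolding comm nat_pow_Suc aa by (simp add: reflection_def m_assoc)
  finally have 2: "conj_by (p \<otimes> a \<otimes> s) s' = conj_by p ((s \<otimes> s') [^] Suc (2 * k) \<otimes> s)" .
  have "crossings p (concat (replicate (Suc k) [s, s'])) =
      map (\<lambda>i. conj_by p ((s \<otimes> s') [^] i \<otimes> s)) [0..<2 * k] @ crossings (p \<otimes> a) [s, s']"
    unfolding w using Suc.IH l by (simp only: crossings_append ev_alternating[OF assms(1,2)] c a_def)
  also have "\<dots> = map (\<lambda>i. conj_by p ((s \<otimes> s') [^] i \<otimes> s)) ([0..<2 * k] @ [2 * k, Suc (2 * k)])"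
    by (simp only: crossings.simps 1 2 map_append list.map)
  finally show ?case by simp
qed auto

text \<open>For an alternating relator of length \<open>2 * k\<close>, the second half of the path
  crosses the same walls as the first, because \<open>(s \<otimes> s') [^] k\<close> is trivial. For
  \<open>[s, s]\<close> one edge is traversed back and forth.\<close>

lemma even_crossings_relator:
  assumes "r \<in> cox_relators S m" "p \<in> carrier G"
  shows "even (count_list (crossings p r) t)"
proof -
  consider (sq) s where "s \<in> S" "r = [s, s]"
    | (alt) s s' k where "s \<in> S" "s' \<in> S" "r = concat (replicate k [s, s'])"
    using assms(1) by (auto simp: cox_relators_def)
  then show ?thesis
  proof cases
    case sq
    then have "conj_by (p \<otimes> s) s = conj_by p s"
      using assms(2) by (simp add: reflection_def inv_mult_group m_assoc)
    then show ?thesis using sq by simp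
  next
    case alt
    let ?f = "\<lambda>i. conj_by p ((s \<otimes> s') [^] (i::nat) \<otimes> s)"
    have "(s \<otimes> s') [^] k = \<one>"
      using ev_relator[OF assms(1)] alt ev_alternating by simp
    then have per: "?f (i + k) = ?f i" for i
      using alt nat_pow_mult[of "s \<otimes> s'" i k] by simp
    have "map ?f [0..<2 * k] = map ?f [0..<k] @ map ?f [0 + k..<k + k]"
      by (simp only: mult_2 upt_add_eq_append[of 0 k k] map_append add_0 le0)
    also have "map ?f [0 + k..<k + k] = map ?f (map (\<lambda>i. i + k) [0..<k])"
      by (simp only: map_add_upt add_0)
    also have "\<dots> = map ?f [0..<k]"
      unfolding map_map o_def per ..
    finally have "crossings p r = map ?f [0..<k] @ map ?f [0..<k]"
      using crossings_alternating alt assms(2) by simp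
    then show ?thesis by simp
  qed
qed

text \<open>A relator contributes evenly to each count and does not move the end point. Membership
  in \<open>lists S\<close> is carried through the induction because the intermediate words of a
  chain are not assumed to be over \<open>S\<close>.\<close>

lemma cox_equiv_crossings:
  "cox_equiv S m u v \<Longrightarrow> (u \<in> lists S \<longleftrightarrow> v \<in> lists S) \<and>
    (u \<in> lists S \<longrightarrow> (\<forall>p\<in>carrier G. even (count_list (crossings p u) t) =
       even (count_list (crossings p v) t)))"
proof (induction rule: cox_equiv.induct)
  case (del r u v)
  then show ?case
    using relator_lists[OF del] ev_relator[OF del] even_crossings_relator[OF del]
    by (auto simp: crossings_append)
qed auto

text \<open>Says that \<open>x\<close> and \<open>y\<close> lie on different sides of the wall of
  \<open>t\<close>. Only the parity of the number of crossings survives the relators; by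
  \<open>sep_word\<close> the choice of the path does not matter.\<close>

definition sep :: "'g \<Rightarrow> 'g \<Rightarrow> 'g \<Rightarrow> bool" where
  "sep t x y \<longleftrightarrow> (\<exists>w\<in>lists S. x \<otimes> ev w = y \<and> odd (count_list (crossings x w) t))"

lemma sep_word:
  assumes "x \<in> carrier G" "w \<in> lists S"
  shows "sep t x (x \<otimes> ev w) \<longleftrightarrow> odd (count_list (crossings x w) t)"
proof -
  have "odd (count_list (crossings x w) t)"
    if "v \<in> lists S" "x \<otimes> ev v = x \<otimes> ev w" "odd (count_list (crossings x v) t)" for v
  proof -
    have "ev v = ev w" using that assms by simp
    then show ?thesis
      using presented cox_equiv_crossings that assms by metis
  qed
  then show ?thesis using assms by (auto simp: sep_def)
qed

lemma word_between:
  assumes "x \<in> carrier G" "y \<in> carrier G"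
  obtains w where "w \<in> lists S" "y = x \<otimes> ev w"
proof -
  have "inv x \<otimes> y \<in> word_eval G ` lists S" using assms generated by (metis inv_closed m_closed)
  then obtain w where "w \<in> lists S" "inv x \<otimes> y = ev w" by auto
  moreover then have "y = x \<otimes> ev w" using assms by (metis inv_solve_left ev_carrier)
  ultimately show ?thesis using that by blast
qed

text \<open>Parities add when paths are concatenated. Consequently a wall has at most two
  sides.\<close>

lemma sep_trans:
  assumes "x \<in> carrier G" "y \<in> carrier G" "z \<in> carrier G"
  shows "sep t x z \<longleftrightarrow> sep t x y \<noteq> sep t y z"
proof -
  obtain u v where "u \<in> lists S" "v \<in> lists S" "y = x \<otimes> ev u" "z = y \<otimes> ev v"
    using word_between assms by metis
  then show ?thesis
    using sep_word[of x u t] sep_word[of "x \<otimes> ev u" v t] sep_word[of x "u @ v" t] assms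
    by (auto simp: crossings_append m_assoc)
qed

lemma sep_refl [simp]: "x \<in> carrier G \<Longrightarrow> \<not> sep t x x"
  using sep_trans by blast

lemma sep_sym: "x \<in> carrier G \<Longrightarrow> y \<in> carrier G \<Longrightarrow> sep t x y \<longleftrightarrow> sep t y x"
  using sep_trans sep_refl by blast

lemma sep_edge: "x \<in> carrier G \<Longrightarrow> s \<in> S \<Longrightarrow> sep t x (x \<otimes> s) \<longleftrightarrow> t = conj_by x s"
  using sep_word[of x "[s]" t] by auto

lemma conj_by_mult:
  "g \<in> carrier G \<Longrightarrow> h \<in> carrier G \<Longrightarrow> x \<in> carrier G \<Longrightarrow> conj_by (g \<otimes> h) x = conj_by g (conj_by h x)"
  by (simp add: reflection_def inv_mult_group m_assoc)

lemma conj_by_eq_iff: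
  "g \<in> carrier G \<Longrightarrow> x \<in> carrier G \<Longrightarrow> y \<in> carrier G \<Longrightarrow> conj_by g x = conj_by g y \<longleftrightarrow> x = y"
  by (simp add: reflection_def)

lemma crossings_translate:
  "q \<in> carrier G \<Longrightarrow> p \<in> carrier G \<Longrightarrow> w \<in> lists S \<Longrightarrow>
    crossings (q \<otimes> p) w = map (conj_by q) (crossings p w)"
  by (induction w arbitrary: p) (auto simp: conj_by_mult m_assoc)

lemma crossings_carrier: "p \<in> carrier G \<Longrightarrow> w \<in> lists S \<Longrightarrow> set (crossings p w) \<subseteq> carrier G"
  by (induction w arbitrary: p) auto

lemma sep_translate:
  assumes "q \<in> carrier G" "t \<in> carrier G" "x \<in> carrier G" "y \<in> carrier G"
  shows "sep (conj_by q t) (q \<otimes> x) (q \<otimes> y) \<longleftrightarrow> sep t x y"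
proof -
  obtain w where w: "w \<in> lists S" "y = x \<otimes> ev w" using word_between assms by metis
  \<comment> \<open>Conjugation by \<open>q\<close> is injective, so distinct entries of the
    crossing list stay distinct.\<close>
  have "count_list (map (conj_by q) l) (conj_by q t) = count_list l t" if "set l \<subseteq> carrier G" for l
    using that assms by (induction l) (auto simp: conj_by_eq_iff)
  then show ?thesis
    using w assms sep_word[of "q \<otimes> x" w "conj_by q t"] sep_word[of x w t]
    by (simp add: crossings_translate crossings_carrier m_assoc)
qed

subsection \<open>Word metric and half-spaces\<close>

lemma geodesic_word:
  assumes "x \<in> carrier G" "y \<in> carrier G"
  obtains w where "w \<in> lists S" "length w = dist x y" "y = x \<otimes> ev w"
proof -
  obtain w where "w \<in> lists S" "y = x \<otimes> ev w" using word_between assms by metis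
  then have "\<exists>n. \<exists>w\<in>lists S. length w = n \<and> x \<otimes> ev w = y" by blast
  from LeastI_ex[OF this] show ?thesis using that unfolding word_dist_def by blast
qed

lemma dist_le: "w \<in> lists S \<Longrightarrow> dist x (x \<otimes> ev w) \<le> length w"
  unfolding word_dist_def by (rule Least_le) auto

lemma dist_refl [simp]: "x \<in> carrier G \<Longrightarrow> dist x x = 0"
  using dist_le[of "[]" x] by simp

lemma dist_edge_le: "x \<in> carrier G \<Longrightarrow> s \<in> S \<Longrightarrow> dist x (x \<otimes> s) \<le> 1"
  using dist_le[of "[s]" x] by simp

lemma dist_triangle:
  assumes "x \<in> carrier G" "y \<in> carrier G" "z \<in> carrier G"
  shows "dist x z \<le> dist x y + dist y z"
proof -
  obtain u v where uv: "u \<in> lists S" "length u = dist x y" "y = x \<otimes> ev u"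
    "v \<in> lists S" "length v = dist y z" "z = y \<otimes> ev v"
    using geodesic_word assms by metis
  then have "z = x \<otimes> ev (u @ v)" using assms by (simp add: m_assoc)
  then show ?thesis using dist_le[of "u @ v" x] uv by auto
qed

lemma rev_lists: "w \<in> lists S \<Longrightarrow> rev w \<in> lists S"
  by (simp add: in_lists_conv_set)

lemma ev_rev: "w \<in> lists S \<Longrightarrow> ev (rev w) = inv (ev w)"
  by (induction w) (simp_all add: inv_mult_group rev_lists)

lemma dist_sym:
  assumes "x \<in> carrier G" "y \<in> carrier G"
  shows "dist x y = dist y x"
proof -
  have "dist b a \<le> dist a b" if ab: "a \<in> carrier G" "b \<in> carrier G" for a b
  proof -
    obtain w where w: "w \<in> lists S" "length w = dist a b" "b = a \<otimes> ev w"
      using geodesic_word ab by metis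
    then have "a = b \<otimes> ev (rev w)" using ab by (simp add: ev_rev m_assoc)
    then show ?thesis using dist_le[OF rev_lists[OF w(1)], of b] w(2) by simp
  qed
  then show ?thesis using assms by (simp add: antisym)
qed

lemma dist_translate:
  "g \<in> carrier G \<Longrightarrow> x \<in> carrier G \<Longrightarrow> y \<in> carrier G \<Longrightarrow> dist (g \<otimes> x) (g \<otimes> y) = dist x y"
  unfolding word_dist_def
  by (rule arg_cong[where f = Least], rule ext) (auto simp: m_assoc)

lemma dist_mult_right:
  "x \<in> carrier G \<Longrightarrow> a \<in> carrier G \<Longrightarrow> dist x (x \<otimes> a) = dist \<one> a"
  using dist_translate[of x \<one> a] by simp

lemma geodesic_point:
  assumes "x \<in> carrier G" "y \<in> carrier G" "k \<le> dist x y"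
  obtains z where "z \<in> carrier G" "dist x z = k" "dist x z + dist z y = dist x y"
proof -
  obtain w where w: "w \<in> lists S" "length w = dist x y" "y = x \<otimes> ev w"
    using geodesic_word assms by metis
  define z where "z = x \<otimes> ev (take k w)"
  have tw: "take k w \<in> lists S" "drop k w \<in> lists S"
    using w(1) unfolding in_lists_conv_set by (meson in_set_takeD in_set_dropD)+
  have "ev w = ev (take k w) \<otimes> ev (drop k w)"
    using ev_append[OF tw] unfolding append_take_drop_id .
  then have y: "y = z \<otimes> ev (drop k w)"
    unfolding w(3) z_def using tw assms by (simp only: m_assoc ev_carrier)
  have z: "z \<in> carrier G" using tw assms by (simp add: z_def)
  have "dist x z \<le> k" using dist_le[OF tw(1), of x] unfolding z_def by simp
  moreover have "dist z y \<le> dist x y - k"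
    using dist_le[OF tw(2), of z] unfolding y[symmetric] length_drop w(2) .
  moreover have "dist x y \<le> dist x z + dist z y" using dist_triangle assms z by simp
  ultimately have "dist x z = k" "dist x z + dist z y = dist x y" using assms(3) by auto
  then show ?thesis using that z by blast
qed

text \<open>Finiteness of \<open>S\<close> enters here; the pigeonhole arguments for points on
  geodesics rest on it.\<close>

lemma finite_ball: "finite {x \<in> carrier G. dist \<one> x \<le> n}"
proof (rule finite_subset)
  show "{x \<in> carrier G. dist \<one> x \<le> n} \<subseteq> ev ` {w. set w \<subseteq> S \<and> length w \<le> n}"
  proof
    fix x assume "x \<in> {x \<in> carrier G. dist \<one> x \<le> n}"
    then have x: "x \<in> carrier G" "dist \<one> x \<le> n" by auto
    obtain w where "w \<in> lists S" "length w = dist \<one> x" "x = \<one> \<otimes> ev w"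
      using geodesic_word x(1) by (metis one_closed)
    then show "x \<in> ev ` {w. set w \<subseteq> S \<and> length w \<le> n}" using x by auto
  qed
qed (simp add: finite_S finite_lists_length_le)

lemma crossing_split:
  assumes "x \<in> carrier G" "w \<in> lists S" "t \<in> set (crossings x w)"
  obtains u s v where "w = u @ s # v" "u \<in> lists S" "s \<in> S" "v \<in> lists S" "t = conj_by (x \<otimes> ev u) s"
proof -
  have "\<exists>u s v. w = u @ s # v \<and> u \<in> lists S \<and> s \<in> S \<and> v \<in> lists S \<and> t = conj_by (x \<otimes> ev u) s"
    using assms
  proof (induction w arbitrary: x)
    case (Cons a w)
    show ?case
    proof (cases "t = conj_by x a")
      case True
      then have "a # w = [] @ a # w \<and> [] \<in> lists S \<and> a \<in> S \<and> w \<in> lists S \<and>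
          t = conj_by (x \<otimes> ev []) a"
        using Cons.prems by auto
      then show ?thesis by blast
    next
      case False
      then have "\<exists>u s v. w = u @ s # v \<and> u \<in> lists S \<and> s \<in> S \<and> v \<in> lists S \<and>
          t = conj_by (x \<otimes> a \<otimes> ev u) s"
        using Cons.prems by (intro Cons.IH) auto
      then obtain u s v where "w = u @ s # v" "u \<in> lists S" "s \<in> S" "v \<in> lists S"
        "t = conj_by (x \<otimes> a \<otimes> ev u) s" by blast
      then have "a # w = (a # u) @ s # v \<and> a # u \<in> lists S \<and> s \<in> S \<and> v \<in> lists S \<and>
          t = conj_by (x \<otimes> ev (a # u)) s"
        using Cons.prems by (auto simp: m_assoc)
      then show ?thesis by blast
    qed
  qed simp
  then show ?thesis using that by blast
qed

lemma conj_by_reflects: "x \<in> carrier G \<Longrightarrow> s \<in> S \<Longrightarrow> conj_by x s \<otimes> x = x \<otimes> s"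
  by (simp add: reflection_def m_assoc)

text \<open>If a geodesic crossed the wall twice, reflecting the part between the two crossings
  would give a path with the same end points that is shorter by two.\<close>
lemma no_double_crossing:
  assumes c: "x \<in> carrier G" "y \<in> carrier G" "z \<in> carrier G"
    and between: "dist x z + dist z y = dist x y"
    and sep: "sep t x z" "sep t z y"
  shows False
proof -
  obtain u v where uv: "u \<in> lists S" "length u = dist x z" "z = x \<otimes> ev u"
    "v \<in> lists S" "length v = dist z y" "y = z \<otimes> ev v"
    using geodesic_word c by metis
  have mem: "t \<in> set (crossings p w)"
    if "sep t p (p \<otimes> ev w)" "p \<in> carrier G" "w \<in> lists S" for p w
  proof (rule ccontr)
    assume "t \<notin> set (crossings p w)"
    then have "count_list (crossings p w) t = 0" by simp
    then show False using that sep_word by simp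
  qed
  obtain u1 s u2 where u: "u = u1 @ s # u2" "u1 \<in> lists S" "s \<in> S" "u2 \<in> lists S"
    "t = conj_by (x \<otimes> ev u1) s"
    using crossing_split[OF c(1) uv(1)] mem[of x u] sep uv c by metis
  obtain v1 s' v2 where v: "v = v1 @ s' # v2" "v1 \<in> lists S" "s' \<in> S" "v2 \<in> lists S"
    "t = conj_by (z \<otimes> ev v1) s'"
    using crossing_split[OF c(3) uv(4)] mem[of z v] sep uv c by metis
  have t: "t \<in> carrier G" using u c by simp
  have tu: "t \<otimes> (x \<otimes> ev u1) = x \<otimes> ev u1 \<otimes> s"
    unfolding u(5) using u c by (intro conj_by_reflects) auto
  have tu': "t \<otimes> (x \<otimes> ev u1 \<otimes> s) = x \<otimes> ev u1"
  proof -
    have "t \<otimes> (x \<otimes> ev u1 \<otimes> s) = t \<otimes> (x \<otimes> ev u1) \<otimes> s" using t u c by (simp add: m_assoc)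
    then show ?thesis unfolding tu using u c by (simp add: m_assoc)
  qed
  have "y = (z \<otimes> ev v1 \<otimes> s') \<otimes> ev v2"
    using uv v c by (simp add: m_assoc)
  also have "z \<otimes> ev v1 \<otimes> s' = t \<otimes> (z \<otimes> ev v1)"
    unfolding v(5) using v c by (intro conj_by_reflects[symmetric]) auto
  also have "z = x \<otimes> ev u1 \<otimes> s \<otimes> ev u2"
    using uv u c by (simp add: m_assoc)
  also have "t \<otimes> (x \<otimes> ev u1 \<otimes> s \<otimes> ev u2 \<otimes> ev v1) = t \<otimes> (x \<otimes> ev u1 \<otimes> s) \<otimes> ev u2 \<otimes> ev v1"
    using t u v c by (simp add: m_assoc)
  also have "\<dots> = x \<otimes> ev u1 \<otimes> ev u2 \<otimes> ev v1"
    unfolding tu' ..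
  finally have "y = x \<otimes> ev (u1 @ u2 @ v1 @ v2)"
    using u v c by (simp add: m_assoc)
  then have "dist x y \<le> length (u1 @ u2 @ v1 @ v2)"
    using dist_le[of "u1 @ u2 @ v1 @ v2" x] u v by simp
  moreover have "dist x y = length u + length v" using uv between by simp
  ultimately show False using u(1) v(1) by simp
qed

text \<open>A geodesic that leaves one side and ends on it again would cross the wall twice.\<close>

lemma half_space_convex:
  assumes "x \<in> carrier G" "y \<in> carrier G" "z \<in> carrier G"
    and "dist x z + dist z y = dist x y" and "\<not> sep t x y"
  shows "\<not> sep t x z"
  using no_double_crossing[OF assms(1-4)] sep_trans[OF assms(1,3,2)] assms(5) by blast

text \<open>Links walls as sets of edges with reflections. An edge invariant under \<open>s\<close>
  is flipped by it, which determines \<open>s\<close> as a conjugate of the label of the edge;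
  translation by \<open>g\<close> gives the general case.\<close>

lemma edge_in_wall_iff:
  assumes "x \<in> carrier G" "a \<in> S" "g \<in> carrier G" "s \<in> S"
  shows "{x, x \<otimes> a} \<in> wall G S g s \<longleftrightarrow> conj_by x a = conj_by g s"
proof
  assume "{x, x \<otimes> a} \<in> wall G S g s"
  then obtain e where e: "e \<in> cayley_edges G S" "lmult G s ` e = e" "{x, x \<otimes> a} = lmult G g ` e"
    by (auto simp: wall_def wall_gen_def)
  then obtain y b where y: "y \<in> carrier G" "b \<in> S" "e = {y, y \<otimes> b}"
    by (auto simp: cayley_edges_def)
  \<comment> \<open>Left multiplication by the nontrivial \<open>s\<close> fixes no vertex, so an
    invariant edge has its ends exchanged.\<close>
  have "s \<otimes> y \<noteq> y"
    using y assms S_not_one by (metis S_carrier r_cancel_one)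
  then have sy: "s \<otimes> y = y \<otimes> b" using e(2) y by (auto simp: lmult_def doubleton_eq_iff)
  have "s = s \<otimes> y \<otimes> inv y" using y assms by (simp add: m_assoc)
  also have "\<dots> = conj_by y b" unfolding sy reflection_def ..
  finally have s: "s = conj_by y b" .
  \<comment> \<open>Edges are unordered, so both orientations occur; in the reversed one the label
    is the same because \<open>b\<close> is an involution.\<close>
  have "x = g \<otimes> y \<and> x \<otimes> a = g \<otimes> (y \<otimes> b) \<or> x = g \<otimes> (y \<otimes> b) \<and> x \<otimes> a = g \<otimes> y"
    using e(3) y by (auto simp: lmult_def doubleton_eq_iff)
  then show "conj_by x a = conj_by g s"
  proof
    assume *: "x = g \<otimes> y \<and> x \<otimes> a = g \<otimes> (y \<otimes> b)"
    then have "x \<otimes> b = g \<otimes> (y \<otimes> b)" using y assms by (simp add: m_assoc)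
    with * have "x \<otimes> a = x \<otimes> b" by metis
    then have "a = b" using y assms by (metis S_carrier Units_eq Units_l_cancel)
    then show ?thesis using s * y assms by (simp add: conj_by_mult)
  next
    assume *: "x = g \<otimes> (y \<otimes> b) \<and> x \<otimes> a = g \<otimes> y"
    then have "x \<otimes> b = g \<otimes> y" using y assms by (simp add: m_assoc)
    with * have "x \<otimes> a = x \<otimes> b" by metis
    then have "a = b" using y assms by (metis S_carrier Units_eq Units_l_cancel)
    moreover have "conj_by b b = b" using y by (simp add: reflection_def m_assoc)
    ultimately show ?thesis using s * y assms by (simp add: conj_by_mult)
  qed
next
  assume eq: "conj_by x a = conj_by g s"
  define y where "y = inv g \<otimes> x"
  have y: "y \<in> carrier G" "g \<otimes> y = x" using assms by (auto simp: y_def simp flip: m_assoc)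
  have "conj_by g (conj_by y a) = conj_by g s"
    using eq y assms by (simp flip: conj_by_mult)
  then have s: "s = conj_by y a" using y assms by (simp add: conj_by_eq_iff)
  have "s \<otimes> y = y \<otimes> a" unfolding s using y assms by (intro conj_by_reflects)
  moreover have "s \<otimes> (y \<otimes> a) = y"
    unfolding calculation[symmetric] using y assms by simp
  ultimately have "{y, y \<otimes> a} \<in> wall_gen G S s"
    using y assms unfolding wall_gen_def cayley_edges_def lmult_def by auto
  moreover have "{x, x \<otimes> a} = lmult G g ` {y, y \<otimes> a}"
    using y assms by (simp add: lmult_def flip: m_assoc)
  ultimately show "{x, x \<otimes> a} \<in> wall G S g s" unfolding wall_def by blast
qed

text \<open>Steps avoiding the wall never change sides. Conversely, a geodesic from
  \<open>\<one>\<close> to a point on the same side stays there by convexity, so it uses no edge of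
  the wall.\<close>

lemma half_minus_eq:
  assumes "g \<in> carrier G" "s \<in> S"
  shows "half_minus G S (wall G S g s) = {y \<in> carrier G. \<not> sep (conj_by g s) \<one> y}"
proof -
  let ?M = "wall G S g s" and ?t = "conj_by g s"
  let ?R = "{(x, z). {x, z} \<in> cayley_edges G S - ?M}"
  have "y \<in> carrier G \<and> \<not> sep ?t \<one> y" if "(\<one>, y) \<in> ?R\<^sup>*" for y
    using that
  proof (induction rule: rtrancl_induct)
    case (step y z)
    then have "{y, z} \<in> cayley_edges G S" and nM: "{y, z} \<notin> ?M" by auto
    then obtain x a where x: "x \<in> carrier G" "a \<in> S" "{y, z} = {x, x \<otimes> a}"
      by (auto simp: cayley_edges_def)
    have "\<not> sep ?t x (x \<otimes> a)"
      using nM x assms by (auto simp: edge_in_wall_iff sep_edge)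
    moreover from x(3) have "y = x \<and> z = x \<otimes> a \<or> y = x \<otimes> a \<and> z = x"
      by (auto simp: doubleton_eq_iff)
    ultimately have "z \<in> carrier G" "\<not> sep ?t y z"
      using x sep_sym[of x "x \<otimes> a"] by auto
    then show ?case using step.IH sep_trans by blast
  qed simp
  moreover have "(\<one>, y) \<in> ?R\<^sup>*" if y: "y \<in> carrier G" "\<not> sep ?t \<one> y" for y
    using that
  proof (induction "dist \<one> y" arbitrary: y)
    case 0
    then obtain w where "w \<in> lists S" "length w = dist \<one> y" "y = \<one> \<otimes> ev w"
      using geodesic_word by (metis one_closed)
    then show ?case using 0 by auto
  next
    case (Suc n)
    then obtain w where w: "w \<in> lists S" "length w = dist \<one> y" "y = \<one> \<otimes> ev w"
      using geodesic_word by (metis one_closed)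
    then obtain v a where v: "w = v @ [a]" "v \<in> lists S" "a \<in> S"
      using Suc.hyps(2) by (cases w rule: rev_cases) auto
    define z where "z = ev v"
    have z: "z \<in> carrier G" "y = z \<otimes> a" using v w by (auto simp: z_def)
    have "dist \<one> z \<le> n" using dist_le[OF v(2), of \<one>] v w Suc.hyps(2) by (simp add: z_def)
    moreover have "dist z y \<le> 1" using z v dist_edge_le by simp
    moreover have "Suc n \<le> dist \<one> z + dist z y"
      using dist_triangle[of \<one> z y] z Suc by simp
    ultimately have d: "dist \<one> z = n" "dist \<one> z + dist z y = dist \<one> y"
      using Suc.hyps(2) by auto
    have nz: "\<not> sep ?t \<one> z"
      using half_space_convex[of \<one> y z ?t] z d Suc.prems by simp
    then have "\<not> sep ?t z y" using sep_trans[of \<one> z y ?t] z Suc.prems by simp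
    then have "{z, y} \<notin> ?M" using z v assms by (simp add: edge_in_wall_iff sep_edge)
    moreover have "{z, y} \<in> cayley_edges G S" using z v unfolding cayley_edges_def by blast
    ultimately have "(z, y) \<in> ?R" by simp
    moreover have "(\<one>, z) \<in> ?R\<^sup>*" using Suc.hyps(1)[of z] d z nz by simp
    ultimately show ?case by (rule rtrancl_into_rtrancl[rotated])
  qed
  ultimately show ?thesis unfolding half_minus_def by blast
qed

lemma half_plus_eq:
  "g \<in> carrier G \<Longrightarrow> s \<in> S \<Longrightarrow>
    half_plus G S (wall G S g s) = {y \<in> carrier G. sep (conj_by g s) \<one> y}"
  unfolding half_plus_def by (auto simp: half_minus_eq)

end

locale hyperbolic_coxeter_group = coxeter_group G S m
  for G :: "('g, 'b) monoid_scheme" (structure) and S m +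
  fixes \<delta> :: real
  assumes \<delta>_nonneg: "\<delta> \<ge> 0"
    and hyperbolic: "\<And>w x y z. w \<in> carrier G \<Longrightarrow> x \<in> carrier G \<Longrightarrow> y \<in> carrier G \<Longrightarrow> z \<in> carrier G \<Longrightarrow>
      gromov_prod G S w x z \<ge> min (gromov_prod G S w x y) (gromov_prod G S w y z) - \<delta>"
begin

abbreviation gp :: "'g \<Rightarrow> 'g \<Rightarrow> real" where "gp \<equiv> gromov_prod G S \<one>"
abbreviation bdry :: "(nat \<Rightarrow> 'g) set set" where "bdry \<equiv> gromov_boundary G S"
abbreviation top_bdry :: "(nat \<Rightarrow> 'g) set topology" where "top_bdry \<equiv> boundary_topology G S"

subsection \<open>Sequences converging to the boundary\<close>

lemma gp_sym: "x \<in> carrier G \<Longrightarrow> y \<in> carrier G \<Longrightarrow> gp x y = gp y x"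
  by (simp add: gromov_prod_def dist_sym[of x y])

lemma gp_self: "x \<in> carrier G \<Longrightarrow> gp x x = real (dist \<one> x)"
  by (simp add: gromov_prod_def)

lemma gp_hyp:
  assumes "x \<in> carrier G" "y \<in> carrier G" "z \<in> carrier G" "K \<le> gp x y" "K \<le> gp y z"
  shows "K - \<delta> \<le> gp x z"
  using hyperbolic[of \<one> x y z] assms by simp

lemma gp_perturb:
  assumes "a \<in> carrier G" "a' \<in> carrier G" "b \<in> carrier G"
  shows "gp a b - real (dist a a') \<le> gp a' b"
proof -
  have "dist \<one> a \<le> dist \<one> a' + dist a a'" "dist a' b \<le> dist a a' + dist a b"
    using dist_triangle[of \<one> a' a] dist_triangle[of a' a b] dist_sym[of a a'] assms by auto
  then show ?thesis by (simp add: gromov_prod_def field_simps)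
qed

lemma gromov_prod_translate:
  assumes "g \<in> carrier G" "w \<in> carrier G" "x \<in> carrier G" "y \<in> carrier G"
  shows "gromov_prod G S (g \<otimes> w) (g \<otimes> x) (g \<otimes> y) = gromov_prod G S w x y"
  using assms by (simp add: gromov_prod_def dist_translate)

lemma conv_infty_iff:
  "conv_infty G S x \<longleftrightarrow> (\<forall>i. x i \<in> carrier G) \<and> (\<forall>K. \<exists>N. \<forall>i\<ge>N. \<forall>j\<ge>N. K \<le> gp (x i) (x j))"
  unfolding conv_infty_def filterlim_at_top eventually_prod_sequentially by simp blast

lemma seq_equiv_iff: "seq_equiv G S x y \<longleftrightarrow> (\<forall>K. \<exists>N. \<forall>i\<ge>N. K \<le> gp (x i) (y i))"
  unfolding seq_equiv_def filterlim_at_top eventually_sequentially by auto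

lemma seq_equiv_refl: "conv_infty G S x \<Longrightarrow> seq_equiv G S x x"
  unfolding conv_infty_iff seq_equiv_iff by meson

lemma seq_equiv_sym:
  "conv_infty G S x \<Longrightarrow> conv_infty G S y \<Longrightarrow> seq_equiv G S x y \<Longrightarrow> seq_equiv G S y x"
  unfolding conv_infty_iff seq_equiv_iff by (metis gp_sym)

lemma seq_equiv_trans:
  assumes "conv_infty G S x" "conv_infty G S y" "conv_infty G S z"
    and "seq_equiv G S x y" "seq_equiv G S y z"
  shows "seq_equiv G S x z"
  unfolding seq_equiv_iff
proof
  fix K
  obtain N1 where N1: "\<And>i. i \<ge> N1 \<Longrightarrow> K + \<delta> \<le> gp (x i) (y i)"
    using assms(4) unfolding seq_equiv_iff by meson
  obtain N2 where N2: "\<And>i. i \<ge> N2 \<Longrightarrow> K + \<delta> \<le> gp (y i) (z i)"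
    using assms(5) unfolding seq_equiv_iff by meson
  have "K \<le> gp (x i) (z i)" if "i \<ge> max N1 N2" for i
    using gp_hyp[of "x i" "y i" "z i" "K + \<delta>"] N1[of i] N2[of i] that assms(1-3)
    by (auto simp: conv_infty_iff)
  then show "\<exists>N. \<forall>i\<ge>N. K \<le> gp (x i) (z i)" by blast
qed

lemma boundary_conv: "\<xi> \<in> bdry \<Longrightarrow> x \<in> \<xi> \<Longrightarrow> conv_infty G S x"
  by (auto simp: gromov_boundary_def bclass_def)

lemma boundary_carrier: "\<xi> \<in> bdry \<Longrightarrow> x \<in> \<xi> \<Longrightarrow> x i \<in> carrier G"
  using boundary_conv by (simp add: conv_infty_def)

text \<open>Any member can serve as the representative, since \<open>seq_equiv\<close> is an
  equivalence on sequences converging to infinity.\<close>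

lemma boundary_mem_iff:
  assumes "\<xi> \<in> bdry" "x \<in> \<xi>"
  shows "y \<in> \<xi> \<longleftrightarrow> conv_infty G S y \<and> seq_equiv G S x y"
proof -
  obtain z where z: "conv_infty G S z" "\<xi> = bclass G S z"
    using assms(1) by (auto simp: gromov_boundary_def)
  then have x: "conv_infty G S x" "seq_equiv G S z x" using assms(2) by (auto simp: bclass_def)
  show ?thesis
    unfolding z(2) bclass_def mem_Collect_eq
    using z(1) x seq_equiv_trans seq_equiv_sym by blast
qed

lemma boundary_nonempty: "\<xi> \<in> bdry \<Longrightarrow> \<exists>x. x \<in> \<xi>"
  by (auto simp: gromov_boundary_def bclass_def intro: seq_equiv_refl)

lemma boundary_eqI: "\<xi> \<in> bdry \<Longrightarrow> \<eta> \<in> bdry \<Longrightarrow> x \<in> \<xi> \<Longrightarrow> x \<in> \<eta> \<Longrightarrow> \<xi> = \<eta>"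
  using boundary_mem_iff by blast

text \<open>\<open>seq_equiv\<close> compares equal indices only; inserting \<open>x j\<close>
  between \<open>x i\<close> and \<open>y j\<close> makes the indices independent at the cost of
  \<open>\<delta>\<close>.\<close>

lemma boundary_gp_large:
  assumes "\<xi> \<in> bdry" "x \<in> \<xi>" "y \<in> \<xi>"
  obtains N where "\<And>i j. i \<ge> N \<Longrightarrow> j \<ge> N \<Longrightarrow> K \<le> gp (x i) (y j)"
proof -
  have x: "conv_infty G S x" using boundary_conv assms by blast
  have y: "conv_infty G S y" "seq_equiv G S x y"
    using boundary_mem_iff[OF assms(1,2), of y] assms(3) by auto
  obtain N1 where N1: "\<And>i j. i \<ge> N1 \<Longrightarrow> j \<ge> N1 \<Longrightarrow> K + \<delta> \<le> gp (x i) (x j)"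
    using x unfolding conv_infty_iff by meson
  obtain N2 where N2: "\<And>i. i \<ge> N2 \<Longrightarrow> K + \<delta> \<le> gp (x i) (y i)"
    using y unfolding seq_equiv_iff by meson
  have "K \<le> gp (x i) (y j)" if "i \<ge> max N1 N2" "j \<ge> max N1 N2" for i j
    using gp_hyp[of "x i" "x j" "y j" "K + \<delta>"] N1[of i j] N2[of j] that x y
    by (auto simp: conv_infty_iff)
  then show ?thesis using that by blast
qed

lemma boundary_dist_large:
  assumes "\<xi> \<in> bdry" "x \<in> \<xi>"
  obtains N where "\<And>i. i \<ge> N \<Longrightarrow> K \<le> real (dist \<one> (x i))"
proof -
  obtain N where "\<And>i j. i \<ge> N \<Longrightarrow> j \<ge> N \<Longrightarrow> K \<le> gp (x i) (x j)"
    using boundary_gp_large assms by metis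
  then show ?thesis using that gp_self boundary_carrier[OF assms] by metis
qed

lemma boundary_subseq:
  assumes "\<xi> \<in> bdry" "x \<in> \<xi>" "strict_mono \<phi>"
  shows "x \<circ> \<phi> \<in> \<xi>"
proof -
  have large: "\<exists>N. \<forall>i\<ge>N. \<forall>j\<ge>N. K \<le> gp (x i) (x j)" for K
    using boundary_gp_large[OF assms(1,2,2), of K] by meson
  have mono: "i \<le> \<phi> i" for i using seq_suble[OF assms(3)] .
  have "conv_infty G S (x \<circ> \<phi>)"
    unfolding conv_infty_iff comp_def
    using boundary_carrier[OF assms(1,2)] large mono by (meson order_trans)
  moreover have "seq_equiv G S x (x \<circ> \<phi>)"
    unfolding seq_equiv_iff comp_def using large mono by (meson order_trans)
  ultimately show ?thesis using boundary_mem_iff[OF assms(1,2)] by blast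
qed

text \<open>Recognises a representative of \<open>\<xi>\<close> chosen term by term: each
  \<open>c n\<close> only has to match the tail of \<open>x\<close> up to precision
  \<open>n - K\<close>. Two terms of \<open>c\<close> are compared through one common far term of
  \<open>x\<close>.\<close>

lemma boundary_approx:
  assumes \<xi>: "\<xi> \<in> bdry" "x \<in> \<xi>" and c: "\<And>n. c n \<in> carrier G"
    and close: "\<And>n::nat. \<exists>N. \<forall>i\<ge>N. real n - K \<le> gp (c n) (x i)"
  shows "c \<in> \<xi>"
proof -
  have x: "x i \<in> carrier G" for i using boundary_carrier[OF \<xi>] .
  have "min (real n) (real k) - K - \<delta> \<le> gp (c n) (c k)" for n k
  proof -
    obtain N1 N2 where "\<forall>i\<ge>N1. real n - K \<le> gp (c n) (x i)" "\<forall>i\<ge>N2. real k - K \<le> gp (c k) (x i)"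
      using close by meson
    then have "real n - K \<le> gp (c n) (x (max N1 N2))" "real k - K \<le> gp (x (max N1 N2)) (c k)"
      using gp_sym[OF c x] by auto
    then show ?thesis
      using gp_hyp[OF c x c, of "min (real n) (real k) - K" n "max N1 N2" k] by auto
  qed
  note cc = this
  have "conv_infty G S c"
    unfolding conv_infty_iff
  proof (intro conjI allI c)
    fix L
    obtain N where "L + K + \<delta> \<le> real N" using real_arch_simple by blast
    then have "L \<le> gp (c i) (c j)" if "i \<ge> N" "j \<ge> N" for i j
      using cc[of i j] that by auto
    then show "\<exists>N. \<forall>i\<ge>N. \<forall>j\<ge>N. L \<le> gp (c i) (c j)" by blast
  qed
  moreover have "seq_equiv G S x c"
    unfolding seq_equiv_iff
  proof
    fix L
    obtain N1 where N1: "\<And>i j. i \<ge> N1 \<Longrightarrow> j \<ge> N1 \<Longrightarrow> L + \<delta> \<le> gp (x i) (x j)"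
      using boundary_gp_large[OF \<xi> \<xi>(2)] by metis
    obtain N2 where N2: "L + K + \<delta> \<le> real N2" using real_arch_simple by blast
    have "L \<le> gp (x n) (c n)" if n: "n \<ge> max N1 N2" for n
    proof -
      obtain M where "\<forall>i\<ge>M. real n - K \<le> gp (c n) (x i)" using close by blast
      \<comment> \<open>The index \<open>max M n\<close> is late enough both for closeness to
        \<open>c n\<close> and for comparison with \<open>x n\<close>.\<close>
      then have "L + \<delta> \<le> gp (x (max M n)) (c n)"
        using gp_sym[OF c x] N2 n by (smt (verit) max.cobounded1 max.bounded_iff of_nat_mono)
      moreover have "L + \<delta> \<le> gp (x n) (x (max M n))"
        using N1[of n "max M n"] n by (simp add: le_max_iff_disj)
      ultimately show ?thesis using gp_hyp[OF x x c, of "L + \<delta>" n "max M n" n] by simp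
    qed
    then show "\<exists>N. \<forall>i\<ge>N. L \<le> gp (x i) (c i)" by blast
  qed
  ultimately show ?thesis using boundary_mem_iff[OF \<xi>] by blast
qed

text \<open>The point \<open>z\<close> lies at distance \<open>(1|y)\<close> from \<open>x\<close>, where the product has base point \<open>x\<close>; it
  is chosen to make \<open>(x|z)\<close> and \<open>(z|y)\<close> equal up to rounding.\<close>
lemma geodesic_near_one:
  assumes "x \<in> carrier G" "y \<in> carrier G"
  obtains z where "z \<in> carrier G" "dist x z + dist z y = dist x y"
    "real (dist \<one> z) \<le> gp x y + 2 * \<delta> + 1 / 2"
proof -
  have tri: "dist \<one> y \<le> dist \<one> x + dist x y" "dist \<one> x \<le> dist \<one> y + dist x y"
    using dist_triangle[of \<one> x y] dist_triangle[of \<one> y x] dist_sym[of x y] assms by auto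
  define k where "k = (dist \<one> x + dist x y - dist \<one> y) div 2"
  have k: "k \<le> dist x y" "2 * k \<le> dist \<one> x + dist x y - dist \<one> y"
    "dist \<one> x + dist x y - dist \<one> y \<le> 2 * k + 1"
    using tri by (auto simp: k_def)
  obtain z where z: "z \<in> carrier G" "dist x z = k" "dist x z + dist z y = dist x y"
    using geodesic_point[OF assms k(1)] by metis
  have kr: "2 * real k \<le> real (dist \<one> x) + real (dist x y) - real (dist \<one> y)"
    "real (dist \<one> x) + real (dist x y) - real (dist \<one> y) \<le> 2 * real k + 1"
    using k(2,3) tri by linarith+
  have zy: "real (dist z y) = real (dist x y) - real k" using z(2,3) by linarith
  have 1: "(real (dist \<one> z) + gp x y) / 2 - 1 / 4 \<le> gp x z"
    using kr by (simp add: gromov_prod_def z(2) field_simps)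
  have 2: "(real (dist \<one> z) + gp x y) / 2 - 1 / 4 \<le> gp z y"
    using kr by (simp add: gromov_prod_def zy field_simps)
  have "real (dist \<one> z) \<le> gp x y + 2 * \<delta> + 1 / 2"
    using gp_hyp[OF assms(1) z(1) assms(2) 1 2] by (simp add: field_simps)
  then show ?thesis using that z by blast
qed

text \<open>Failure of \<open>seq_equiv\<close> bounds the product at infinitely many indices only,
  which is why later arguments work with infinite index sets.\<close>

lemma distinct_bounded_gp:
  assumes "\<xi> \<in> bdry" "\<eta> \<in> bdry" "\<xi> \<noteq> \<eta>" "x \<in> \<xi>" "y \<in> \<eta>"
  obtains K where "\<exists>\<^sub>\<infinity>i. gp (x i) (y i) \<le> K"
proof -
  have "\<not> seq_equiv G S x y"
    using boundary_mem_iff[OF assms(1,4)] boundary_conv[OF assms(2,5)] assms boundary_eqI by blast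
  then obtain K where "\<forall>N. \<exists>i\<ge>N. gp (x i) (y i) < K"
    unfolding seq_equiv_iff by (meson not_le)
  then have "\<exists>\<^sub>\<infinity>i. gp (x i) (y i) \<le> K" unfolding INFM_nat_le by (meson less_imp_le)
  then show ?thesis using that by blast
qed

text \<open>Bounded displacement changes Gromov products by a bounded amount. This allows points
  \<open>p n \<otimes> z\<close> of an orbit to be replaced by the group elements
  \<open>p n\<close>.\<close>

lemma boundary_perturb:
  assumes \<xi>: "\<xi> \<in> bdry" "c \<in> \<xi>" and p: "\<And>n. p n \<in> carrier G"
    and D: "\<And>n. real (dist (c n) (p n)) \<le> D"
  shows "p \<in> \<xi>"
proof -
  have c: "c n \<in> carrier G" for n using boundary_carrier[OF \<xi>] .
  have cp: "gp (c i) b - D \<le> gp (p i) b" if "b \<in> carrier G" for i b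
    using gp_perturb[OF c p that, of i i] D[of i] by simp
  have large: "\<exists>N. \<forall>i\<ge>N. \<forall>j\<ge>N. K \<le> gp (c i) (c j)" for K
    using boundary_gp_large[OF \<xi> \<xi>(2), of K] by meson
  have cp1: "gp (c i) (c j) - D \<le> gp (c i) (p j)" for i j
    using cp[OF c[of i], of j] gp_sym[OF c c, of i j] gp_sym[OF c p, of i j] by simp
  have cp2: "gp (c i) (c j) - 2 * D \<le> gp (p i) (p j)" for i j
    using cp[OF p, of i j] cp1[of i j] by simp
  have "conv_infty G S p"
    unfolding conv_infty_iff
  proof (intro conjI allI p)
    fix K
    obtain N where "\<forall>i\<ge>N. \<forall>j\<ge>N. K + 2 * D \<le> gp (c i) (c j)" using large by blast
    then have "\<forall>i\<ge>N. \<forall>j\<ge>N. K \<le> gp (p i) (p j)" using cp2 by (smt (verit))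
    then show "\<exists>N. \<forall>i\<ge>N. \<forall>j\<ge>N. K \<le> gp (p i) (p j)" by blast
  qed
  moreover have "seq_equiv G S c p"
    unfolding seq_equiv_iff
  proof
    fix K
    obtain N where "\<forall>i\<ge>N. \<forall>j\<ge>N. K + D \<le> gp (c i) (c j)" using large by blast
    then have "\<forall>i\<ge>N. K \<le> gp (c i) (p i)" using cp1 by (smt (verit))
    then show "\<exists>N. \<forall>i\<ge>N. K \<le> gp (c i) (p i)" by blast
  qed
  ultimately show ?thesis using boundary_mem_iff[OF \<xi>] by blast
qed

subsection \<open>Topology of the boundary\<close>

text \<open>Opening the abstract \<open>topology\<close> requires the axioms of a topology;
  intersections work because the sets \<open>?N \<xi> r\<close> shrink as \<open>r\<close>
  grows.\<close>

lemma openin_boundary: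
  "openin top_bdry U \<longleftrightarrow> U \<subseteq> bdry \<and> (\<forall>\<xi>\<in>U. \<exists>r::real. {\<eta> \<in> bdry. bgromov_prod G S \<xi> \<eta> > ereal r} \<subseteq> U)"
proof -
  let ?N = "\<lambda>\<xi> r. {\<eta> \<in> bdry. bgromov_prod G S \<xi> \<eta> > ereal r}"
  have mono: "?N \<xi> (max r r') \<subseteq> ?N \<xi> r" "?N \<xi> (max r r') \<subseteq> ?N \<xi> r'" for \<xi> r r'
    by (auto simp: max_def split: if_splits elim: order.strict_trans1[rotated])
  have "istopology (\<lambda>U. U \<subseteq> bdry \<and> (\<forall>\<xi>\<in>U. \<exists>r::real. ?N \<xi> r \<subseteq> U))"
    unfolding istopology_def
  proof (intro conjI allI impI; (elim conjE)?)
    fix U V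
    assume U: "U \<subseteq> bdry" "\<forall>\<xi>\<in>U. \<exists>r. ?N \<xi> r \<subseteq> U" and V: "V \<subseteq> bdry" "\<forall>\<xi>\<in>V. \<exists>r. ?N \<xi> r \<subseteq> V"
    show "U \<inter> V \<subseteq> bdry" using U by blast
    show "\<forall>\<xi>\<in>U \<inter> V. \<exists>r. ?N \<xi> r \<subseteq> U \<inter> V"
    proof
      fix \<xi> assume "\<xi> \<in> U \<inter> V"
      then obtain r r' where "?N \<xi> r \<subseteq> U" "?N \<xi> r' \<subseteq> V" using U V by blast
      then have "?N \<xi> (max r r') \<subseteq> U \<inter> V" using mono by blast
      then show "\<exists>r. ?N \<xi> r \<subseteq> U \<inter> V" by blast
    qed
  next
    fix \<K> assume *: "\<forall>U\<in>\<K>. U \<subseteq> bdry \<and> (\<forall>\<xi>\<in>U. \<exists>r. ?N \<xi> r \<subseteq> U)"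
    show "\<Union>\<K> \<subseteq> bdry" using * by blast
    show "\<forall>\<xi>\<in>\<Union>\<K>. \<exists>r. ?N \<xi> r \<subseteq> \<Union>\<K>" using * by (meson Union_iff Union_upper order_trans)
  qed
  then show ?thesis unfolding boundary_topology_def by (simp add: topology_inverse')
qed

lemma topspace_boundary [simp]: "topspace top_bdry = bdry"
proof
  show "topspace top_bdry \<subseteq> bdry" using openin_boundary openin_topspace by blast
  have "openin top_bdry bdry" by (auto simp: openin_boundary)
  then show "bdry \<subseteq> topspace top_bdry" by (rule openin_subset)
qed

text \<open>As the product is a supremum, a strict lower bound is already witnessed by a single pair
  of representatives.\<close>

lemma bgromov_prod_gtD:
  assumes "bgromov_prod G S \<xi> \<eta> > ereal r"
  obtains x y N where "x \<in> \<xi>" "y \<in> \<eta>" "\<And>i j. i \<ge> N \<Longrightarrow> j \<ge> N \<Longrightarrow> r \<le> gp (x i) (y j)"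
proof -
  obtain x y where xy: "x \<in> \<xi>" "y \<in> \<eta>"
    "ereal r < Liminf (sequentially \<times>\<^sub>F sequentially) (\<lambda>(i, j). ereal (gp (x i) (y j)))"
    using assms unfolding bgromov_prod_def less_SUP_iff by blast
  have "\<forall>\<^sub>F p in sequentially \<times>\<^sub>F sequentially. ereal r < (\<lambda>(i, j). ereal (gp (x i) (y j))) p"
    using less_LiminfD[OF xy(3)] by simp
  then obtain N where N: "\<And>i j. i \<ge> N \<Longrightarrow> j \<ge> N \<Longrightarrow> r < gp (x i) (y j)"
    unfolding eventually_prod_sequentially by auto
  show ?thesis by (rule that[OF xy(1,2)]) (auto dest: N intro: less_imp_le)
qed

text \<open>The lower limit inherits only the non-strict bound \<open>r\<close>; the gap
  \<open>r' < r\<close> restores strictness.\<close>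

lemma bgromov_prod_gtI:
  assumes "x \<in> \<xi>" "y \<in> \<eta>" "\<And>i j. i \<ge> N \<Longrightarrow> j \<ge> N \<Longrightarrow> r < gp (x i) (y j)" "r' < r"
  shows "bgromov_prod G S \<xi> \<eta> > ereal r'"
proof -
  have "\<forall>\<^sub>F p in sequentially \<times>\<^sub>F sequentially. ereal r \<le> (\<lambda>(i, j). ereal (gp (x i) (y j))) p"
    unfolding eventually_prod_sequentially using assms(3) by (auto intro: less_imp_le)
  then have "ereal r \<le> Liminf (sequentially \<times>\<^sub>F sequentially) (\<lambda>(i, j). ereal (gp (x i) (y j)))"
    by (rule Liminf_bounded)
  also have "\<dots> \<le> bgromov_prod G S \<xi> \<eta>"
    unfolding bgromov_prod_def by (intro SUP_upper2[OF assms(1)] SUP_upper2[OF assms(2)] order_refl)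
  finally show ?thesis using assms(4) by (metis ereal_less(2) less_ereal.simps(1) less_le_trans)
qed

text \<open>Diagonal argument: if points of the limit set came arbitrarily close to
  \<open>\<xi>\<close>, one element of \<open>E\<close> could be picked from a representative of
  each, and by \<open>boundary_approx\<close> the picked sequence represents
  \<open>\<xi>\<close>.\<close>

lemma closedin_limit_set:
  assumes E: "E \<subseteq> carrier G"
  shows "closedin top_bdry (limit_set G S E)"
  unfolding closedin_def topspace_boundary
proof
  show "limit_set G S E \<subseteq> bdry" by (auto simp: limit_set_def)
  show "openin top_bdry (bdry - limit_set G S E)"
    unfolding openin_boundary
  proof (intro conjI ballI)
    fix \<xi> assume \<xi>: "\<xi> \<in> bdry - limit_set G S E"
    show "\<exists>r::real. {\<eta> \<in> bdry. bgromov_prod G S \<xi> \<eta> > ereal r} \<subseteq> bdry - limit_set G S E"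
    proof (rule ccontr)
      assume "\<not> ?thesis"
      then have no: "\<exists>\<eta>. \<eta> \<in> limit_set G S E \<and> bgromov_prod G S \<xi> \<eta> > ereal r" for r by blast
      obtain x where x: "x \<in> \<xi>" using boundary_nonempty \<xi> by blast
      have "\<exists>c. c \<in> E \<and> (\<exists>N. \<forall>i\<ge>N. real n - 2 * \<delta> \<le> gp c (x i))" for n :: nat
      proof -
        obtain \<eta> where \<eta>: "\<eta> \<in> limit_set G S E" "bgromov_prod G S \<xi> \<eta> > ereal (real n)"
          using no by blast
        then obtain e where e: "e \<in> \<eta>" "\<And>i. e i \<in> E" and \<eta>b: "\<eta> \<in> bdry"
          by (auto simp: limit_set_def)
        obtain x' y N1 where x': "x' \<in> \<xi>" "y \<in> \<eta>"
          and N1: "\<And>i j. i \<ge> N1 \<Longrightarrow> j \<ge> N1 \<Longrightarrow> real n \<le> gp (x' i) (y j)"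
          using bgromov_prod_gtD[OF \<eta>(2)] by metis
        obtain N2 where N2: "\<And>i j. i \<ge> N2 \<Longrightarrow> j \<ge> N2 \<Longrightarrow> real n \<le> gp (y i) (e j)"
          using boundary_gp_large[OF \<eta>b x'(2) e(1)] by metis
        obtain N3 where N3: "\<And>i j. i \<ge> N3 \<Longrightarrow> j \<ge> N3 \<Longrightarrow> real n \<le> gp (x' i) (x j)"
          using boundary_gp_large[of \<xi> x' x] \<xi> x x' by (metis DiffD1)
        \<comment> \<open>In the chain \<open>e M\<close>, \<open>y M\<close>, \<open>x' M\<close>,
          \<open>x i\<close> consecutive products are at least \<open>n\<close>, so two uses of
          hyperbolicity cost \<open>2 * \<delta>\<close>.\<close>
        define M where "M = max N1 (max N2 N3)"
        then have M: "N1 \<le> M" "N2 \<le> M" "N3 \<le> M" by auto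
        have c: "x' i \<in> carrier G" "y i \<in> carrier G" "e i \<in> carrier G" "x i \<in> carrier G" for i
          using boundary_carrier x' \<eta>b x \<xi> e E by blast+
        have "real n - \<delta> \<le> gp (e M) (x' M)"
          using gp_hyp[OF c(3,2,1), of "real n" M M M] N1[of M M] N2[of M M] M
            gp_sym[OF c(3,2)] gp_sym[OF c(2,1)] by simp
        then have "real n - 2 * \<delta> \<le> gp (e M) (x i)" if "i \<ge> M" for i
          using gp_hyp[OF c(3,1,4), of "real n - \<delta>" M M i] N3[of M i] that M \<delta>_nonneg by simp
        then show ?thesis using e(2) by blast
      qed
      then obtain c where c: "\<And>n. c n \<in> E" "\<And>n. \<exists>N. \<forall>i\<ge>N. real n - 2 * \<delta> \<le> gp (c n) (x i)"
        by metis
      then have "c \<in> \<xi>" using boundary_approx[of \<xi> x c] \<xi> x E by blast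
      then have "\<xi> \<in> limit_set G S E" using \<xi> c(1) by (auto simp: limit_set_def)
      then show False using \<xi> by blast
    qed
  qed blast
qed

end

section \<open>Invariant subsets of the boundary, cutting reflections and the core\<close>

locale reflection_invariant_set = hyperbolic_coxeter_group G S m \<delta>
  for G :: "('g, 'b) monoid_scheme" (structure) and S m \<delta> +
  fixes F :: "(nat \<Rightarrow> 'g) set set"
  assumes F_sub: "F \<subseteq> bdry"
    and two_points: "\<exists>\<xi>\<in>F. \<exists>\<eta>\<in>F. \<xi> \<noteq> \<eta>"
    and F_invariant: "\<And>g s. g \<in> carrier G \<Longrightarrow> s \<in> S \<Longrightarrow> cuts G S (wall G S g s) F \<Longrightarrow>
      bact G (conj_by g s) ` F = F"
begin

text \<open>Representatives turn statements about boundary points into statements about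
  vertices.\<close>

definition F_seqs :: "(nat \<Rightarrow> 'g) set" where
  "F_seqs = \<Union>F"

text \<open>Agrees with \<open>cuts\<close> by \<open>cuts_iff\<close>, but depends on the
  reflection alone and not on the base point \<open>\<one>\<close>, which makes it convenient under
  translation.\<close>

definition cut :: "'g \<Rightarrow> bool" where
  "cut t \<longleftrightarrow> (\<exists>x\<in>F_seqs. \<exists>y\<in>F_seqs. \<forall>i j. sep t (x i) (y j))"

definition refls :: "'g set" where
  "refls = {conj_by g s | g s. g \<in> carrier G \<and> s \<in> S}"

definition cut_group :: "'g set" where
  "cut_group = generate G {t \<in> refls. cut t}"

definition stab :: "'g set" where
  "stab = boundary_stabilizer G F"

text \<open>The intersection of the half-spaces \<open>H\<close> for which \<open>F\<close> does not meet the limit set of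
  the complement of \<open>H\<close>; sequences all of whose terms lie on one side stand in for limit sets.\<close>
definition core :: "'g set" where
  "core = {z \<in> carrier G. \<forall>t\<in>refls. \<not> cut t \<longrightarrow> \<not> (\<exists>w\<in>F_seqs. \<forall>i. sep t z (w i))}"

lemma cutI: "x \<in> F_seqs \<Longrightarrow> y \<in> F_seqs \<Longrightarrow> (\<And>i j. sep t (x i) (y j)) \<Longrightarrow> cut t"
  unfolding cut_def by blast

lemma F_boundary: "\<xi> \<in> F \<Longrightarrow> \<xi> \<in> bdry"
  using F_sub by blast

lemma F_seqsI: "\<xi> \<in> F \<Longrightarrow> x \<in> \<xi> \<Longrightarrow> x \<in> F_seqs"
  by (auto simp: F_seqs_def)

lemma F_seqsE:
  assumes "x \<in> F_seqs"
  obtains \<xi> where "\<xi> \<in> F" "x \<in> \<xi>"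
  using assms by (auto simp: F_seqs_def)

lemma F_carrier: "x \<in> F_seqs \<Longrightarrow> x i \<in> carrier G"
  using boundary_carrier F_boundary by (metis F_seqsE)

lemma F_subseq: "x \<in> F_seqs \<Longrightarrow> strict_mono \<phi> \<Longrightarrow> x \<circ> \<phi> \<in> F_seqs"
  using boundary_subseq F_boundary by (metis F_seqsE F_seqsI)

lemma refls_carrier: "t \<in> refls \<Longrightarrow> t \<in> carrier G"
  by (auto simp: refls_def)

lemma refls_conj: "g \<in> carrier G \<Longrightarrow> t \<in> refls \<Longrightarrow> conj_by g t \<in> refls"
  unfolding refls_def using conj_by_mult m_closed S_carrier by (smt (verit) mem_Collect_eq)

lemma core_carrier: "z \<in> core \<Longrightarrow> z \<in> carrier G"
  by (simp add: core_def)

lemma cuts_iff: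
  assumes "g \<in> carrier G" "s \<in> S"
  shows "cuts G S (wall G S g s) F \<longleftrightarrow> cut (conj_by g s)"
proof -
  let ?t = "conj_by g s"
  have lim: "F \<inter> limit_set G S {y \<in> carrier G. Q y} \<noteq> {} \<longleftrightarrow> (\<exists>x\<in>F_seqs. \<forall>i. Q (x i))" for Q
  proof
    assume "F \<inter> limit_set G S {y \<in> carrier G. Q y} \<noteq> {}"
    then show "\<exists>x\<in>F_seqs. \<forall>i. Q (x i)" unfolding limit_set_def using F_seqsI by auto
  next
    assume "\<exists>x\<in>F_seqs. \<forall>i. Q (x i)"
    then obtain x \<xi> where "\<xi> \<in> F" "x \<in> \<xi>" "\<forall>i. Q (x i)" using F_seqsE by metis
    moreover from this have "\<forall>i. x i \<in> carrier G" using F_carrier F_seqsI by metis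
    ultimately have "\<xi> \<in> F \<inter> limit_set G S {y \<in> carrier G. Q y}"
      unfolding limit_set_def using F_boundary by auto
    then show "F \<inter> limit_set G S {y \<in> carrier G. Q y} \<noteq> {}" by blast
  qed
  have "cuts G S (wall G S g s) F \<longleftrightarrow>
      (\<exists>x\<in>F_seqs. \<forall>i. \<not> sep ?t \<one> (x i)) \<and> (\<exists>y\<in>F_seqs. \<forall>i. sep ?t \<one> (y i))"
    unfolding cuts_def half_minus_eq[OF assms] half_plus_eq[OF assms] lim ..
  also have "\<dots> \<longleftrightarrow> cut ?t"
  proof
    assume "(\<exists>x\<in>F_seqs. \<forall>i. \<not> sep ?t \<one> (x i)) \<and> (\<exists>y\<in>F_seqs. \<forall>i. sep ?t \<one> (y i))"
    then obtain x y where xy: "x \<in> F_seqs" "y \<in> F_seqs" and s: "\<forall>i. \<not> sep ?t \<one> (x i)" "\<forall>i. sep ?t \<one> (y i)"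
      by blast
    have "sep ?t (x i) (y j)" for i j
      using sep_trans[OF one_closed F_carrier[OF xy(1)] F_carrier[OF xy(2)]] s by blast
    then show "cut ?t" unfolding cut_def using xy by blast
  next
    assume "cut ?t"
    then obtain x y where xy: "x \<in> F_seqs" "y \<in> F_seqs" and sep: "\<And>i j. sep ?t (x i) (y j)"
      unfolding cut_def by blast
    have *: "sep ?t \<one> (y j) \<longleftrightarrow> \<not> sep ?t \<one> (x i)" for i j
      using sep_trans[OF one_closed F_carrier[OF xy(1)] F_carrier[OF xy(2)]] sep by blast
    \<comment> \<open>Nothing in \<open>cut\<close> tells which of the two sequences lies on the
      side of \<open>\<one>\<close>; the side of \<open>x 0\<close> decides.\<close>
    show "(\<exists>x\<in>F_seqs. \<forall>i. \<not> sep ?t \<one> (x i)) \<and> (\<exists>y\<in>F_seqs. \<forall>i. sep ?t \<one> (y i))"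
    proof (cases "sep ?t \<one> (x 0)")
      case True
      then have "\<forall>j. \<not> sep ?t \<one> (y j)" "\<forall>i. sep ?t \<one> (x i)" using * by blast+
      then show ?thesis using xy by blast
    next
      case False
      then have "\<forall>j. sep ?t \<one> (y j)" "\<forall>i. \<not> sep ?t \<one> (x i)" using * by blast+
      then show ?thesis using xy by blast
    qed
  qed
  finally show ?thesis .
qed

lemma cut_group_eq:
  "cut_group = generate G {conj_by g s | g s. g \<in> carrier G \<and> s \<in> S \<and> cuts G S (wall G S g s) F}"
proof -
  have "{t \<in> refls. cut t} = {conj_by g s | g s. g \<in> carrier G \<and> s \<in> S \<and> cuts G S (wall G S g s) F}"
    unfolding refls_def using cuts_iff by blast
  then show ?thesis unfolding cut_group_def by simp
qed

subsection \<open>The stabilizer acts on the core\<close>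

lemma stab_carrier: "q \<in> stab \<Longrightarrow> q \<in> carrier G"
  by (simp add: stab_def boundary_stabilizer_def)

lemma stab_image: "q \<in> stab \<Longrightarrow> bact G q ` F = F"
  by (simp add: stab_def boundary_stabilizer_def)

lemma stab_closed:
  assumes "q \<in> stab" "x \<in> F_seqs"
  shows "(\<lambda>i. q \<otimes> x i) \<in> F_seqs"
proof -
  obtain \<xi> where \<xi>: "\<xi> \<in> F" "x \<in> \<xi>" using assms(2) by (rule F_seqsE)
  have "bact G q \<xi> \<in> F" using stab_image[OF assms(1)] \<xi>(1) by auto
  moreover have "(\<lambda>i. q \<otimes> x i) \<in> bact G q \<xi>" unfolding bact_def using \<xi>(2) by (rule imageI)
  ultimately show ?thesis by (rule F_seqsI)
qed

lemma stab_surj: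
  assumes "q \<in> stab" "x \<in> F_seqs"
  obtains y where "y \<in> F_seqs" "\<And>i. x i = q \<otimes> y i"
proof -
  obtain \<xi> where \<xi>: "\<xi> \<in> F" "x \<in> \<xi>" using assms(2) by (rule F_seqsE)
  then have "\<xi> \<in> bact G q ` F" using stab_image[OF assms(1)] by simp
  then obtain \<eta> where \<eta>: "\<eta> \<in> F" "\<xi> = bact G q \<eta>" by (rule imageE)
  then have "x \<in> (\<lambda>x i. q \<otimes> x i) ` \<eta>" using \<xi>(2) unfolding bact_def by simp
  then obtain y where "y \<in> \<eta>" "x = (\<lambda>i. q \<otimes> y i)" by (rule imageE)
  then show ?thesis using that[of y] F_seqsI[OF \<eta>(1)] by simp
qed

lemma stab_one: "\<one> \<in> stab"
proof -
  have "bact G \<one> \<xi> = \<xi>" if "\<xi> \<in> F" for \<xi>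
  proof -
    have "(\<lambda>i. \<one> \<otimes> x i) = x" if "x \<in> \<xi>" for x
      using F_carrier[OF F_seqsI[OF \<open>\<xi> \<in> F\<close> that]] by simp
    then show ?thesis unfolding bact_def by auto
  qed
  then show ?thesis unfolding stab_def boundary_stabilizer_def by auto
qed

lemma stab_mult:
  assumes "g \<in> stab" "h \<in> stab"
  shows "g \<otimes> h \<in> stab"
proof -
  have "bact G (g \<otimes> h) \<xi> = bact G g (bact G h \<xi>)" if "\<xi> \<in> F" for \<xi>
    unfolding bact_def image_image
    by (rule image_cong[OF HOL.refl])
      (simp add: m_assoc F_carrier[OF F_seqsI[OF that]] stab_carrier[OF assms(1)] stab_carrier[OF assms(2)])
  then have "bact G (g \<otimes> h) ` F = bact G g ` (bact G h ` F)"
    unfolding image_image by (rule image_cong[OF HOL.refl])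
  then show ?thesis
    using assms unfolding stab_def boundary_stabilizer_def by simp
qed

lemma refls_inv: "t \<in> refls \<Longrightarrow> inv t = t"
  by (auto simp: refls_def reflection_def inv_mult_group m_assoc)

lemma cut_refl_stab:
  assumes "t \<in> refls" "cut t"
  shows "t \<in> stab"
proof -
  obtain g s where "t = conj_by g s" "g \<in> carrier G" "s \<in> S" using assms(1) by (auto simp: refls_def)
  then show ?thesis
    using F_invariant[of g s] cuts_iff[of g s] assms by (simp add: stab_def boundary_stabilizer_def)
qed

lemma cut_group_subset_stab: "cut_group \<subseteq> stab"
proof
  fix p assume "p \<in> cut_group"
  then show "p \<in> stab" unfolding cut_group_def
    by (induction rule: generate.induct) (auto simp: refls_inv cut_refl_stab stab_one stab_mult)
qed

lemma cut_group_subgroup: "subgroup cut_group G"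
  unfolding cut_group_def by (rule generate_is_subgroup) (auto simp: refls_carrier)

lemma cut_group_carrier: "p \<in> cut_group \<Longrightarrow> p \<in> carrier G"
  using cut_group_subset_stab stab_carrier by blast

text \<open>An element preserving \<open>F\<close> permutes the walls and respects whether they cut.
  A non-cutting wall that keeps \<open>q \<otimes> z\<close> out of \<open>core\<close> is pulled
  back to one that keeps \<open>z\<close> out.\<close>

lemma core_translate:
  assumes "q \<in> stab" "z \<in> core"
  shows "q \<otimes> z \<in> core"
proof -
  have q: "q \<in> carrier G" and z: "z \<in> carrier G" using assms stab_carrier core_carrier by auto
  have False if t: "t \<in> refls" "\<not> cut t" and w: "w \<in> F_seqs" "\<And>i. sep t (q \<otimes> z) (w i)" for t w
  proof -
    define t' where "t' = conj_by (inv q) t"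
    have t': "t' \<in> refls" unfolding t'_def using q t by (intro refls_conj) auto
    have "conj_by q t' = conj_by (q \<otimes> inv q) t"
      unfolding t'_def using q refls_carrier[OF t(1)] by (subst conj_by_mult) auto
    then have tt: "t = conj_by q t'" using q refls_carrier[OF t(1)] by (simp add: reflection_def)
    obtain y where y: "y \<in> F_seqs" "\<And>i. w i = q \<otimes> y i" using stab_surj[OF assms(1) w(1)] by metis
    have tr: "sep t (q \<otimes> a) (q \<otimes> b) \<longleftrightarrow> sep t' a b" if "a \<in> carrier G" "b \<in> carrier G" for a b
      unfolding tt using sep_translate[OF q refls_carrier[OF t'] that] .
    have "\<not> cut t'"
    proof
      assume "cut t'"
      then obtain a b where "a \<in> F_seqs" "b \<in> F_seqs" "\<And>i j. sep t' (a i) (b j)"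
        unfolding cut_def by blast
      then have "\<forall>i j. sep t (q \<otimes> a i) (q \<otimes> b j)" "(\<lambda>i. q \<otimes> a i) \<in> F_seqs" "(\<lambda>i. q \<otimes> b i) \<in> F_seqs"
        using tr F_carrier stab_closed[OF assms(1)] by blast+
      then have "cut t" by (intro cutI[of "\<lambda>i. q \<otimes> a i" "\<lambda>i. q \<otimes> b i"]) auto
      then show False using t by blast
    qed
    moreover have "sep t' z (y i)" for i
      using w(2)[of i] y(2)[of i] tr[OF z F_carrier[OF y(1)]] by simp
    ultimately show False using assms(2) t' y(1) unfolding core_def by blast
  qed
  then show ?thesis using q z unfolding core_def by blast
qed

subsection \<open>Convexity of the core\<close>

text \<open>Eventually on the side of \<open>F\<close> for each non-cutting wall, where the constant
  side of \<open>w\<close> marks that side. Constant sequences in \<open>core\<close> and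
  representatives of points of \<open>F\<close> share this property, so \<open>core_between\<close>
  treats geodesics between either kind of ends at once.\<close>

definition stays_inside :: "(nat \<Rightarrow> 'g) \<Rightarrow> bool" where
  "stays_inside u \<longleftrightarrow> (\<forall>i. u i \<in> carrier G) \<and>
    (\<forall>t w. t \<in> refls \<longrightarrow> \<not> cut t \<longrightarrow> w \<in> F_seqs \<longrightarrow> (\<forall>i j. \<not> sep t (w i) (w j)) \<longrightarrow>
      (\<exists>N. \<forall>i\<ge>N. \<not> sep t (w 0) (u i)))"

lemma stays_inside_const:
  assumes "z \<in> core"
  shows "stays_inside (\<lambda>_. z)"
proof -
  have "\<not> sep t (w 0) z"
    if "t \<in> refls" "\<not> cut t" and w: "w \<in> F_seqs" "\<And>i j. \<not> sep t (w i) (w j)" for t w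
  proof
    assume s: "sep t (w 0) z"
    have "sep t z (w i)" for i
      using sep_trans[of "w 0" "w i" z t] sep_sym[of "w i" z t] s w F_carrier core_carrier[OF assms]
      by blast
    then show False using assms that unfolding core_def by blast
  qed
  then show ?thesis using core_carrier[OF assms] unfolding stays_inside_def by blast
qed

lemma infinite_subseq:
  assumes "x \<in> F_seqs" "infinite {i. Q (x i)}"
  obtains y where "y \<in> F_seqs" "\<And>i. Q (y i)"
proof -
  obtain \<phi> :: "nat \<Rightarrow> nat" where "strict_mono \<phi>" "\<And>n. \<phi> n \<in> {i. Q (x i)}"
    using infinite_enumerate[OF assms(2)] by blast
  then show ?thesis using that[of "x \<circ> \<phi>"] F_subseq[OF assms(1)] by simp
qed

text \<open>Otherwise a subsequence of \<open>x\<close>, again in \<open>F_seqs\<close>, would lie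
  across the wall from \<open>w\<close>, and the wall would cut.\<close>

lemma stays_inside_F:
  assumes x: "x \<in> F_seqs"
  shows "stays_inside x"
proof -
  have "\<exists>N. \<forall>i\<ge>N. \<not> sep t (w 0) (x i)"
    if t: "t \<in> refls" "\<not> cut t" and w: "w \<in> F_seqs" "\<And>i j. \<not> sep t (w i) (w j)" for t w
  proof (rule ccontr)
    assume "\<not> ?thesis"
    then have "infinite {i. sep t (w 0) (x i)}"
      unfolding infinite_nat_iff_unbounded_le by auto
    then obtain y where y: "y \<in> F_seqs" "\<And>i. sep t (w 0) (y i)"
      using infinite_subseq[OF x, of "sep t (w 0)"] by blast
    have "sep t (w i) (y j)" for i j
      using sep_trans[of "w i" "w 0" "y j" t] w y F_carrier by blast
    then show False using t(2) w(1) y(1) unfolding cut_def by blast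
  qed
  then show ?thesis using F_carrier[OF x] unfolding stays_inside_def by blast
qed

text \<open>For a late index both ends of the geodesic lie on the side of \<open>w\<close>, and
  convexity of half-spaces puts \<open>z\<close> there. Infinitely many indices suffice, since one
  beyond both thresholds is enough.\<close>

lemma core_between:
  assumes u: "stays_inside u" and v: "stays_inside v" and z: "z \<in> carrier G"
    and inf: "\<exists>\<^sub>\<infinity>i. dist (u i) z + dist z (v i) = dist (u i) (v i)"
  shows "z \<in> core"
proof -
  have False if t: "t \<in> refls" "\<not> cut t" and w: "w \<in> F_seqs" "\<And>i. sep t z (w i)" for t w
  proof -
    have wc: "w i \<in> carrier G" for i using F_carrier w by blast
    have same: "\<forall>i j. \<not> sep t (w i) (w j)" using sep_trans[OF z wc wc] w(2) by blast
    obtain N1 N2 where N: "\<forall>i\<ge>N1. \<not> sep t (w 0) (u i)" "\<forall>i\<ge>N2. \<not> sep t (w 0) (v i)"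
      using u v t w(1) same unfolding stays_inside_def by metis
    obtain i where i: "i \<ge> max N1 N2" "dist (u i) z + dist z (v i) = dist (u i) (v i)"
      using inf unfolding INFM_nat_le by blast
    have c: "u i \<in> carrier G" "v i \<in> carrier G" using u v unfolding stays_inside_def by auto
    have "\<not> sep t (w 0) (u i)" "\<not> sep t (w 0) (v i)" using N i by auto
    then have "\<not> sep t (u i) (v i)" using sep_trans[of "w 0" "u i" "v i" t] c wc by blast
    then have "\<not> sep t (u i) z" using half_space_convex[OF c z i(2)] by blast
    then have "\<not> sep t (w 0) z"
      using sep_trans[of "w 0" "u i" z t] \<open>\<not> sep t (w 0) (u i)\<close> c wc z by blast
    then show False using w(2) sep_sym[OF z wc] by blast
  qed
  then show ?thesis using z unfolding core_def by blast
qed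

lemma pigeonhole_ball:
  assumes "infinite A" "\<And>i. i \<in> A \<Longrightarrow> f i \<in> carrier G" "\<And>i. i \<in> A \<Longrightarrow> real (dist \<one> (f i)) \<le> R"
  obtains z where "infinite {i \<in> A. f i = z}" "z \<in> f ` A"
proof -
  have "f ` A \<subseteq> {x \<in> carrier G. dist \<one> x \<le> nat \<lfloor>R\<rfloor>}"
    using assms(2,3) by (auto simp: le_nat_floor)
  then have "finite (f ` A)" using finite_ball finite_subset by blast
  from pigeonhole_infinite[OF assms(1) this] show ?thesis using that by blast
qed

lemma core_nonempty: "core \<noteq> {}"
proof -
  obtain \<xi> \<eta> where F: "\<xi> \<in> F" "\<eta> \<in> F" "\<xi> \<noteq> \<eta>" using two_points by blast
  obtain x y where xy: "x \<in> \<xi>" "y \<in> \<eta>"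
    using boundary_nonempty[OF F_boundary[OF F(1)]] boundary_nonempty[OF F_boundary[OF F(2)]] by blast
  obtain K where K: "\<exists>\<^sub>\<infinity>i. gp (x i) (y i) \<le> K"
    by (rule distinct_bounded_gp[OF F_boundary[OF F(1)] F_boundary[OF F(2)] F(3) xy])
  have xy': "x \<in> F_seqs" "y \<in> F_seqs" using xy F F_seqsI by auto
  note c = F_carrier[OF xy'(1)] F_carrier[OF xy'(2)]
  have "\<exists>z. z \<in> carrier G \<and> dist (x i) z + dist z (y i) = dist (x i) (y i) \<and>
      real (dist \<one> z) \<le> gp (x i) (y i) + 2 * \<delta> + 1 / 2" for i
    by (rule geodesic_near_one[OF c(1)[of i] c(2)[of i]]) blast
  then obtain f where f: "\<And>i. f i \<in> carrier G"
    "\<And>i. dist (x i) (f i) + dist (f i) (y i) = dist (x i) (y i)"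
    "\<And>i. real (dist \<one> (f i)) \<le> gp (x i) (y i) + 2 * \<delta> + 1 / 2" by metis
  \<comment> \<open>At these indices the chosen points \<open>f i\<close> lie in one ball, so one of
    them occurs infinitely often.\<close>
  let ?A = "{i. gp (x i) (y i) \<le> K}"
  have "infinite ?A" using K by (simp add: frequently_cofinite)
  moreover have "real (dist \<one> (f i)) \<le> K + 2 * \<delta> + 1 / 2" if "i \<in> ?A" for i
    using f(3)[of i] that by simp
  ultimately obtain z where z: "infinite {i \<in> ?A. f i = z}" "z \<in> f ` ?A"
    using pigeonhole_ball[of ?A f] f(1) by blast
  have "infinite {i. dist (x i) z + dist z (y i) = dist (x i) (y i)}"
    using z(1) by (rule infinite_super[rotated]) (use f(2) in auto)
  then have "z \<in> core"
    using core_between[OF stays_inside_F[OF xy'(1)] stays_inside_F[OF xy'(2)]] z(2) f(1)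
    unfolding frequently_cofinite by auto
  then show ?thesis by blast
qed

text \<open>The point \<open>c n\<close> lies at distance \<open>n\<close> from a core point
  \<open>z\<close> on geodesics to infinitely many \<open>x i\<close>; it exists by pigeonhole and
  belongs to \<open>core\<close> by \<open>core_between\<close>.\<close>

lemma F_approx_core:
  assumes \<xi>: "\<xi> \<in> F"
  obtains c where "c \<in> \<xi>" "\<And>n. c n \<in> core"
proof -
  have b: "\<xi> \<in> bdry" using \<xi> F_boundary by blast
  obtain z where zc: "z \<in> core" using core_nonempty by blast
  then have z: "z \<in> carrier G" by (rule core_carrier)
  obtain x where x: "x \<in> \<xi>" using boundary_nonempty b by blast
  have xc: "x i \<in> carrier G" for i using boundary_carrier b x by blast
  have "\<exists>c. c \<in> core \<and> (\<exists>N. \<forall>j\<ge>N. real n - (real (dist \<one> z) + \<delta>) \<le> gp c (x j))" for n :: nat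
  proof -
    obtain N where N: "\<And>i. i \<ge> N \<Longrightarrow> real (n + dist \<one> z) \<le> real (dist \<one> (x i))"
      using boundary_dist_large[OF b x] by metis
    have far: "n \<le> dist z (x i)" if "i \<in> {N..}" for i
      using N[of i] that dist_triangle[OF one_closed z xc, of i] by simp
    have "\<exists>y. y \<in> carrier G \<and> dist z y = n \<and> dist z y + dist y (x i) = dist z (x i)"
      if "i \<in> {N..}" for i
      by (rule geodesic_point[OF z xc far[OF that]]) blast
    then obtain f where f: "\<And>i. i \<in> {N..} \<Longrightarrow> f i \<in> carrier G" "\<And>i. i \<in> {N..} \<Longrightarrow> dist z (f i) = n"
      "\<And>i. i \<in> {N..} \<Longrightarrow> dist z (f i) + dist (f i) (x i) = dist z (x i)" by metis
    have near: "real (dist \<one> (f i)) \<le> real (dist \<one> z + n)" if "i \<in> {N..}" for i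
      using dist_triangle[OF one_closed z f(1)[OF that]] f(2)[OF that] by simp
    obtain y where y: "infinite {i \<in> {N..}. f i = y}" "y \<in> f ` {N..}"
      by (rule pigeonhole_ball[OF infinite_Ici f(1) near])
    have yc: "y \<in> carrier G" "dist z y = n" using y(2) f by auto
    have inf: "infinite {i. dist z y + dist y (x i) = dist z (x i)}"
      using y(1) by (rule infinite_super[rotated]) (use f(3) in auto)
    then have "y \<in> core"
      using core_between[OF stays_inside_const[OF zc] stays_inside_F[OF F_seqsI[OF \<xi> x]] yc(1)]
      unfolding frequently_cofinite by blast
    moreover have "\<exists>N. \<forall>j\<ge>N. real n - (real (dist \<one> z) + \<delta>) \<le> gp y (x j)"
    proof -
      obtain M where M: "\<And>i j. i \<ge> M \<Longrightarrow> j \<ge> M \<Longrightarrow> real n \<le> gp (x i) (x j)"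
        using boundary_gp_large[OF b x x] by metis
      obtain i where i: "i \<ge> M" "dist z y + dist y (x i) = dist z (x i)"
        using inf unfolding infinite_nat_iff_unbounded_le by blast
      \<comment> \<open>Moving the base point from \<open>z\<close> to \<open>\<one>\<close> costs
        at most \<open>dist \<one> z\<close>.\<close>
      have "real n \<le> real (dist \<one> z) + real (dist \<one> y)"
        using dist_triangle[OF z one_closed yc(1)] dist_sym[OF z one_closed] yc(2) by linarith
      moreover have "real (dist z (x i)) \<le> real (dist \<one> z) + real (dist \<one> (x i))"
        using dist_triangle[OF z one_closed xc, of i] dist_sym[OF z one_closed] by linarith
      moreover have "real (dist z (x i)) = real n + real (dist y (x i))" using i(2) yc(2) by simp
      ultimately have 1: "real n - real (dist \<one> z) \<le> gp y (x i)"
        unfolding gromov_prod_def by simp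
      have "real n - real (dist \<one> z) - \<delta> \<le> gp y (x j)" if "j \<ge> M" for j
        using gp_hyp[OF yc(1) xc xc 1, of j] M[OF i(1) that] by simp
      then show ?thesis by (auto simp: algebra_simps)
    qed
    ultimately show ?thesis by blast
  qed
  then obtain c where c: "\<And>n. c n \<in> core"
    "\<And>n::nat. \<exists>N. \<forall>j\<ge>N. real n - (real (dist \<one> z) + \<delta>) \<le> gp (c n) (x j)"
    by metis
  then have "c \<in> \<xi>" using boundary_approx[OF b x] core_carrier by blast
  then show ?thesis using that c by blast
qed

subsection \<open>The group generated by the cutting reflections\<close>

text \<open>Each \<open>w i\<close> lies across the wall from one end of the edge, so infinitely
  many lie across from the same end. If the wall did not cut, this subsequence would exclude that
  end from \<open>core\<close>.\<close>

lemma core_edge_cut: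
  assumes "x \<in> core" "s \<in> S" "x \<otimes> s \<in> core"
  shows "conj_by x s \<in> refls" "cut (conj_by x s)"
proof -
  let ?t = "conj_by x s"
  have x: "x \<in> carrier G" and xs: "x \<otimes> s \<in> carrier G" using assms core_carrier by auto
  show t: "?t \<in> refls" unfolding refls_def using x assms(2) by blast
  have not_all: "\<not> (\<forall>i. sep ?t z (w i))" if "\<not> cut ?t" "z \<in> core" "w \<in> F_seqs" for z w
    using that t unfolding core_def by blast
  show "cut ?t"
  proof (rule ccontr)
    assume nc: "\<not> cut ?t"
    obtain \<xi> where \<xi>: "\<xi> \<in> F" using two_points by blast
    obtain w where w: "w \<in> F_seqs"
      using boundary_nonempty[OF F_boundary[OF \<xi>]] F_seqsI[OF \<xi>] by blast
    have or: "sep ?t x (w i) \<or> sep ?t (x \<otimes> s) (w i)" for i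
      using sep_trans[OF x xs F_carrier[OF w], of ?t i] sep_edge[OF x assms(2), of ?t] by blast
    have "infinite {i. sep ?t x (w i)} \<or> infinite {i. sep ?t (x \<otimes> s) (w i)}"
    proof (rule ccontr)
      assume "\<not> ?thesis"
      then have "finite ({i. sep ?t x (w i)} \<union> {i. sep ?t (x \<otimes> s) (w i)})" by simp
      moreover have "{i. sep ?t x (w i)} \<union> {i. sep ?t (x \<otimes> s) (w i)} = UNIV" using or by blast
      ultimately show False by simp
    qed
    then show False
      using infinite_subseq[OF w] not_all[OF nc assms(1)] not_all[OF nc assms(3)] by metis
  qed
qed

text \<open>Induction along a geodesic, which stays in \<open>core\<close>: the reflection in the
  wall of its last edge carries the vertex before \<open>y\<close> to \<open>y\<close>.\<close>

lemma core_transitive: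
  assumes "z \<in> core" "y \<in> core"
  shows "\<exists>p\<in>cut_group. y = p \<otimes> z"
  using assms(2)
proof (induction "dist z y" arbitrary: y)
  have z: "z \<in> carrier G" using assms(1) by (rule core_carrier)
  {
    case 0
    then have y: "y \<in> carrier G" using core_carrier by blast
    obtain w where "w \<in> lists S" "length w = dist z y" "y = z \<otimes> ev w"
      by (rule geodesic_word[OF z y])
    then have "y = \<one> \<otimes> z" using 0 z by simp
    moreover have "\<one> \<in> cut_group" using cut_group_subgroup by (rule subgroup.one_closed)
    ultimately show ?case by blast
  next
    case (Suc n)
    then have y: "y \<in> carrier G" using core_carrier by blast
    have "n \<le> dist z y" using Suc.hyps(2) by simp
    then obtain y' where y': "y' \<in> carrier G" "dist z y' = n" "dist z y' + dist y' y = dist z y"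
      by (rule geodesic_point[OF z y])
    have core': "y' \<in> core"
      using core_between[OF stays_inside_const[OF assms(1)] stays_inside_const[OF Suc.prems] y'(1)]
        y'(3) by (simp add: frequently_cofinite)
    obtain p where p: "p \<in> cut_group" "y' = p \<otimes> z"
      using Suc.hyps(1)[of y'] y'(2) core' by auto
    obtain w where w: "w \<in> lists S" "length w = dist y' y" "y = y' \<otimes> ev w"
      by (rule geodesic_word[OF y'(1) y])
    have "length w = Suc 0" using w(2) y' Suc.hyps(2) by simp
    then obtain s where s: "w = [s]" by (auto simp: length_Suc_conv)
    then have sS: "s \<in> S" and ys: "y = y' \<otimes> s" using w y' by auto
    let ?t = "conj_by y' s"
    have "?t \<in> cut_group"
      unfolding cut_group_def
      using core_edge_cut[OF core' sS] Suc.prems ys by (intro generate.incl) auto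
    then have "?t \<otimes> p \<in> cut_group" using p(1) subgroup.m_closed[OF cut_group_subgroup] by blast
    moreover have "y = ?t \<otimes> p \<otimes> z"
    proof -
      have "?t \<otimes> p \<otimes> z = ?t \<otimes> y'"
        using p cut_group_carrier y' sS z by (simp add: m_assoc)
      then show ?thesis using conj_by_reflects[OF y'(1) sS] ys by simp
    qed
    ultimately show ?case by blast
  }
qed

text \<open>By cancellation, an element is determined by where it sends a single core point.\<close>

lemma stab_eq_cut_group: "stab = cut_group"
proof
  show "stab \<subseteq> cut_group"
  proof
    fix q assume q: "q \<in> stab"
    obtain z where z: "z \<in> core" using core_nonempty by blast
    obtain p where "p \<in> cut_group" "q \<otimes> z = p \<otimes> z"
      using core_transitive[OF z core_translate[OF q z]] by blast
    then show "q \<in> cut_group"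
      using stab_carrier[OF q] cut_group_carrier core_carrier[OF z] by (metis right_cancel)
  qed
qed (rule cut_group_subset_stab)

lemma core_translate': "p \<in> cut_group \<Longrightarrow> z \<in> core \<Longrightarrow> p \<otimes> z \<in> core"
  using core_translate cut_group_subset_stab by blast

text \<open>Core points \<open>c n\<close> tending to \<open>\<xi>\<close> have the form
  \<open>p n \<otimes> z\<close>, at distance at most \<open>dist \<one> z\<close> from
  \<open>p n\<close>, so \<open>p\<close> tends to \<open>\<xi>\<close> as well.\<close>

lemma F_subset_limit_set: "F \<subseteq> limit_set G S cut_group"
proof
  fix \<xi> assume \<xi>: "\<xi> \<in> F"
  obtain c where c: "c \<in> \<xi>" "\<And>n. c n \<in> core" using F_approx_core[OF \<xi>] by blast
  obtain z where z: "z \<in> core" using core_nonempty by blast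
  have "\<forall>n. \<exists>p. p \<in> cut_group \<and> c n = p \<otimes> z" using core_transitive[OF z c(2)] by blast
  then obtain p where p: "\<And>n. p n \<in> cut_group" "\<And>n. c n = p n \<otimes> z" by metis
  have "real (dist (c n) (p n)) \<le> real (dist \<one> z)" for n
    using dist_mult_right[OF cut_group_carrier[OF p(1)] core_carrier[OF z], of n]
      dist_sym[OF core_carrier[OF c(2)] cut_group_carrier[OF p(1)], of n n] p(2)[of n] by simp
  then have "p \<in> \<xi>"
    using boundary_perturb[of \<xi> c p] F_boundary[OF \<xi>] c(1) cut_group_carrier[OF p(1)] by blast
  then show "\<xi> \<in> limit_set G S cut_group"
    unfolding limit_set_def using F_boundary[OF \<xi>] p(1) by blast
qed

text \<open>Conjugation by \<open>z\<close> turns labels of core edges at \<open>z\<close> into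
  cutting reflections. Conversely, core points are reached from \<open>z\<close> by labels in
  \<open>T\<close>, so \<open>p \<otimes> z = z \<otimes> h\<close> and \<open>p\<close> is the
  conjugate of \<open>h\<close>.\<close>

lemma parabolic_cut_group: "parabolic_subgroup G S cut_group"
proof -
  obtain z where z: "z \<in> core" using core_nonempty by blast
  have zc: "z \<in> carrier G" using z by (rule core_carrier)
  define T where "T = {s \<in> S. z \<otimes> s \<in> core}"
  have TS: "T \<subseteq> S" by (auto simp: T_def)
  then have Tc: "T \<subseteq> carrier G" using S_sub by blast
  have gc: "h \<in> generate G T \<Longrightarrow> h \<in> carrier G" for h using generate_in_carrier[OF Tc] .
  have conj_in: "conj_by z h \<in> cut_group" if "h \<in> generate G T" for h
    using that
  proof (induction rule: generate.induct)
    case one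
    then show ?case using zc subgroup.one_closed[OF cut_group_subgroup] by (simp add: reflection_def)
  next
    case (incl s)
    then show ?case unfolding cut_group_def T_def
      using core_edge_cut[OF z, of s] by (intro generate.incl) auto
  next
    case (inv s)
    then have "inv s = s" using TS by auto
    then show ?case using inv unfolding cut_group_def T_def
      using core_edge_cut[OF z, of s] by (intro generate.incl) auto
  next
    case (eng h1 h2)
    have "conj_by z (h1 \<otimes> h2) = conj_by z h1 \<otimes> conj_by z h2"
      using gc eng.hyps zc by (simp add: reflection_def m_assoc inv_solve_left flip: m_assoc)
        (simp add: m_assoc)
    then show ?case using eng.IH subgroup.m_closed[OF cut_group_subgroup] by simp
  qed
  have core_coset: "\<exists>h\<in>generate G T. y = z \<otimes> h" if "y \<in> core" for y
    using that
  proof (induction "dist z y" arbitrary: y)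
    case 0
    then have y: "y \<in> carrier G" using core_carrier by blast
    obtain w where "w \<in> lists S" "length w = dist z y" "y = z \<otimes> ev w"
      by (rule geodesic_word[OF zc y])
    then have "y = z \<otimes> \<one>" using 0 zc by simp
    then show ?case using generate.one by blast
  next
    case (Suc n)
    then have y: "y \<in> carrier G" using core_carrier by blast
    have "n \<le> dist z y" using Suc.hyps(2) by simp
    then obtain y' where y': "y' \<in> carrier G" "dist z y' = n" "dist z y' + dist y' y = dist z y"
      by (rule geodesic_point[OF zc y])
    have core': "y' \<in> core"
      using core_between[OF stays_inside_const[OF z] stays_inside_const[OF Suc.prems] y'(1)]
        y'(3) by (simp add: frequently_cofinite)
    obtain h where h: "h \<in> generate G T" "y' = z \<otimes> h"
      using Suc.hyps(1)[of y'] y'(2) core' by auto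
    obtain w where w: "w \<in> lists S" "length w = dist y' y" "y = y' \<otimes> ev w"
      by (rule geodesic_word[OF y'(1) y])
    have "length w = Suc 0" using w(2) y' Suc.hyps(2) by simp
    then obtain s where s: "w = [s]" by (auto simp: length_Suc_conv)
    then have sS: "s \<in> S" and ys: "y = y' \<otimes> s" using w y' by auto
    \<comment> \<open>Translating the last edge back to \<open>z\<close> keeps its label
      \<open>s\<close> and stays in \<open>core\<close>; hence \<open>s\<close> belongs to
      \<open>T\<close>.\<close>
    obtain p where p: "p \<in> cut_group" "y' = p \<otimes> z" using core_transitive[OF z core'] by blast
    have pc: "p \<in> carrier G" using cut_group_carrier p by blast
    have "inv p \<otimes> y = z \<otimes> s"
      unfolding ys p(2) using pc zc sS by (simp flip: m_assoc)
    moreover have "inv p \<otimes> y \<in> core"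
      using core_translate'[OF subgroup.m_inv_closed[OF cut_group_subgroup p(1)] Suc.prems] .
    ultimately have "s \<in> T" using sS by (simp add: T_def)
    then have "h \<otimes> s \<in> generate G T" using h(1) generate.eng generate.incl by metis
    moreover have "y = z \<otimes> (h \<otimes> s)" using ys h zc gc sS by (simp add: m_assoc)
    ultimately show ?case by blast
  qed
  have "cut_group = conj_by z ` generate G T"
  proof
    show "conj_by z ` generate G T \<subseteq> cut_group" using conj_in by blast
    show "cut_group \<subseteq> conj_by z ` generate G T"
    proof
      fix p assume p: "p \<in> cut_group"
      then obtain h where h: "h \<in> generate G T" "p \<otimes> z = z \<otimes> h"
        using core_coset core_translate'[OF p z] by blast
      have "p = p \<otimes> z \<otimes> inv z" using cut_group_carrier[OF p] zc by (simp add: m_assoc)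
      then have "p = conj_by z h" unfolding reflection_def h(2) .
      then show "p \<in> conj_by z ` generate G T" using h(1) by blast
    qed
  qed
  also have "\<dots> = (z <# generate G T) #> inv z"
    by (auto simp: reflection_def l_coset_def r_coset_def)
  finally have eq: "cut_group = (z <# generate G T) #> inv z" .
  \<comment> \<open>Without labels the core would reduce to \<open>z\<close>, whereas core sequences
    tending to a point of \<open>F\<close> leave every ball.\<close>
  have "T \<noteq> {}"
  proof
    assume "T = {}"
    then have const: "y = z" if "y \<in> core" for y
      using core_coset[OF that] zc by (auto simp: generate_empty)
    obtain \<xi> where \<xi>: "\<xi> \<in> F" using two_points by blast
    obtain c where c: "c \<in> \<xi>" "\<And>n. c n \<in> core" using F_approx_core[OF \<xi>] by blast
    obtain N where "\<And>i. i \<ge> N \<Longrightarrow> real (dist \<one> z) + 1 \<le> real (dist \<one> (c i))"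
      using boundary_dist_large[OF F_boundary[OF \<xi>] c(1)] by blast
    from this[of N] show False using const[OF c(2)[of N]] by simp
  qed
  then show ?thesis unfolding parabolic_subgroup_def using eq zc TS by blast
qed

text \<open>Given \<open>\<alpha> \<noteq> \<beta>\<close> in \<open>F\<close>, a geodesic from \<open>\<alpha>\<close> to \<open>\<beta>\<close> passes within a fixed distance
  of \<open>1\<close>, so its translate by \<open>p\<close> passes near \<open>p\<close> and, seen from \<open>1\<close>, one of the
  end points \<open>p\<alpha>\<close>, \<open>p\<beta>\<close> is close to \<open>p\<close>.\<close>
lemma translate_near:
  assumes "p \<in> carrier G" "a \<in> carrier G" "b \<in> carrier G" "gp a b \<le> K"
  shows "real (dist \<one> p) - (K + \<delta>) \<le> gp p (p \<otimes> a) \<or> real (dist \<one> p) - (K + \<delta>) \<le> gp p (p \<otimes> b)"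
proof -
  have c: "p \<otimes> a \<in> carrier G" "p \<otimes> b \<in> carrier G" using assms by auto
  have "gromov_prod G S p (p \<otimes> a) (p \<otimes> b) = gp a b"
    using gromov_prod_translate[OF assms(1) one_closed assms(2,3)] assms(1) by simp
  then have "min (gromov_prod G S p (p \<otimes> a) \<one>) (gromov_prod G S p \<one> (p \<otimes> b)) \<le> K + \<delta>"
    using hyperbolic[OF assms(1) c(1) one_closed c(2)] assms(4) by simp
  moreover have "gp p (p \<otimes> a) = real (dist \<one> p) - gromov_prod G S p (p \<otimes> a) \<one>"
    using assms c dist_sym[of p \<one>] dist_sym[of "p \<otimes> a" \<one>] by (simp add: gromov_prod_def field_simps)
  moreover have "gp p (p \<otimes> b) = real (dist \<one> p) - gromov_prod G S p \<one> (p \<otimes> b)"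
    using assms c dist_sym[of p \<one>] by (simp add: gromov_prod_def field_simps)
  ultimately show ?thesis by (auto simp: min_le_iff_disj)
qed

lemma limit_set_subset_closure: "limit_set G S cut_group \<subseteq> top_bdry closure_of F"
proof
  fix \<xi> assume \<xi>: "\<xi> \<in> limit_set G S cut_group"
  then obtain p where b: "\<xi> \<in> bdry" and p: "p \<in> \<xi>" "\<And>i. p i \<in> cut_group"
    by (auto simp: limit_set_def)
  have pc: "p i \<in> carrier G" for i using p(2) by (rule cut_group_carrier)
  obtain \<alpha> \<beta> where F: "\<alpha> \<in> F" "\<beta> \<in> F" "\<alpha> \<noteq> \<beta>" using two_points by blast
  obtain x y where xy: "x \<in> \<alpha>" "y \<in> \<beta>"
    using boundary_nonempty[OF F_boundary[OF F(1)]] boundary_nonempty[OF F_boundary[OF F(2)]] by blast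
  obtain K where K: "\<exists>\<^sub>\<infinity>i. gp (x i) (y i) \<le> K"
    by (rule distinct_bounded_gp[OF F_boundary[OF F(1)] F_boundary[OF F(2)] F(3) xy])
  note xs = F_seqsI[OF F(1) xy(1)] and ys = F_seqsI[OF F(2) xy(2)]
  have "\<exists>\<eta>\<in>F. bgromov_prod G S \<xi> \<eta> > ereal r" for r :: real
  proof -
    \<comment> \<open>The \<open>2 * \<delta>\<close> pays for two uses of hyperbolicity; the
      summand 2 leaves room for \<open>r < r + 1 < r + 2\<close>.\<close>
    define L where "L = r + 2 + 2 * \<delta>"
    obtain N1 where N1: "\<And>i j. i \<ge> N1 \<Longrightarrow> j \<ge> N1 \<Longrightarrow> L \<le> gp (p i) (p j)"
      using boundary_gp_large[OF b p(1) p(1)] by blast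
    obtain N2 where N2: "\<And>i. i \<ge> N2 \<Longrightarrow> L + (K + \<delta>) \<le> real (dist \<one> (p i))"
      using boundary_dist_large[OF b p(1)] by blast
    define n where "n = max N1 N2"
    have n: "n \<ge> N1" "L + (K + \<delta>) \<le> real (dist \<one> (p n))" using N2 by (auto simp: n_def)
    have "\<exists>\<^sub>\<infinity>i. L \<le> gp (p n) (p n \<otimes> x i) \<or> L \<le> gp (p n) (p n \<otimes> y i)"
    proof (rule frequently_elim1[OF K])
      fix i assume "gp (x i) (y i) \<le> K"
      from translate_near[OF pc F_carrier[OF xs] F_carrier[OF ys] this, of n] n(2)
      show "L \<le> gp (p n) (p n \<otimes> x i) \<or> L \<le> gp (p n) (p n \<otimes> y i)" by linarith
    qed
    then have "\<exists>u\<in>F_seqs. \<exists>\<^sub>\<infinity>i. L \<le> gp (p n) (p n \<otimes> u i)"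
      unfolding frequently_disj_iff using xs ys by blast
    then obtain u where u: "u \<in> F_seqs" "\<exists>\<^sub>\<infinity>i. L \<le> gp (p n) (p n \<otimes> u i)" by blast
    have "p n \<in> stab" using p(2) cut_group_subset_stab by blast
    then have v: "(\<lambda>i. p n \<otimes> u i) \<in> F_seqs" using u(1) by (rule stab_closed)
    then obtain \<eta> where \<eta>: "\<eta> \<in> F" "(\<lambda>i. p n \<otimes> u i) \<in> \<eta>" by (rule F_seqsE)
    obtain N3 where N3: "\<And>i j. i \<ge> N3 \<Longrightarrow> j \<ge> N3 \<Longrightarrow> L \<le> gp (p n \<otimes> u i) (p n \<otimes> u j)"
      using boundary_gp_large[OF F_boundary[OF \<eta>(1)] \<eta>(2) \<eta>(2)] by blast
    \<comment> \<open>One late \<open>k\<close> with \<open>p n \<otimes> u k\<close> near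
      \<open>p n\<close> suffices, since all late terms of the translated sequence are close to each
      other.\<close>
    obtain k where k: "k \<ge> N3" "L \<le> gp (p n) (p n \<otimes> u k)" using u(2) unfolding INFM_nat_le by blast
    note vc = F_carrier[OF v]
    have "r + 1 < gp (p i) (p n \<otimes> u j)" if "i \<ge> max N1 N3" "j \<ge> max N1 N3" for i j
    proof -
      have 1: "L - \<delta> \<le> gp (p n) (p n \<otimes> u j)"
        using gp_hyp[OF pc vc vc k(2) N3[of k j]] k that by simp
      have "L - \<delta> \<le> gp (p i) (p n)" using N1[of i n] n(1) that \<delta>_nonneg by simp
      from gp_hyp[OF pc pc vc this 1] show ?thesis by (simp add: L_def)
    qed
    then have "bgromov_prod G S \<xi> \<eta> > ereal r"
      by (intro bgromov_prod_gtI[OF p(1) \<eta>(2), of "max N1 N3" "r + 1"]) auto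
    then show ?thesis using \<eta>(1) by blast
  qed
  note near = this
  show "\<xi> \<in> top_bdry closure_of F"
    unfolding in_closure_of topspace_boundary
  proof (intro conjI allI impI b)
    fix U assume U: "\<xi> \<in> U \<and> openin top_bdry U"
    then obtain r :: real where "{\<eta> \<in> bdry. bgromov_prod G S \<xi> \<eta> > ereal r} \<subseteq> U"
      unfolding openin_boundary by blast
    then show "\<exists>\<eta>. \<eta> \<in> F \<and> \<eta> \<in> U" using near[of r] F_boundary by blast
  qed
qed

lemma closure_eq_limit_set: "top_bdry closure_of F = limit_set G S cut_group"
proof
  show "top_bdry closure_of F \<subseteq> limit_set G S cut_group"
    using F_subset_limit_set closedin_limit_set cut_group_carrier
    by (intro closure_of_minimal) auto
qed (rule limit_set_subset_closure)

end

theorem mainTheorem8: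
  fixes G :: "('g, 'b) monoid_scheme" and S :: "'g set" and F :: "(nat \<Rightarrow> 'g) set set"
  assumes cox: "coxeter_system G S"
    and hyp: "gromov_hyperbolic G S"
    and F_sub: "F \<subseteq> gromov_boundary G S"
    and two: "\<exists>\<xi>\<in>F. \<exists>\<eta>\<in>F. \<xi> \<noteq> \<eta>"
    and inv: "\<And>g s. g \<in> carrier G \<Longrightarrow> s \<in> S \<Longrightarrow> cuts G S (wall G S g s) F \<Longrightarrow>
                bact G (reflection G g s) ` F = F"
  defines "P \<equiv> generate G {reflection G g s | g s. g \<in> carrier G \<and> s \<in> S \<and> cuts G S (wall G S g s) F}"
  shows "parabolic_subgroup G S P
       \<and> (boundary_topology G S) closure_of F = limit_set G S P
       \<and> P = boundary_stabilizer G F"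
proof -
  have "group G" and S: "S \<subseteq> carrier G" "finite S"
    using cox by (simp_all add: coxeter_system_def)
  obtain m where m: "carrier G = word_eval G ` lists S"
    "\<forall>u\<in>lists S. \<forall>v\<in>lists S. word_eval G u = word_eval G v \<longleftrightarrow> cox_equiv S m u v"
    using cox unfolding coxeter_system_def by (elim conjE exE) (rule that)
  obtain \<delta> where \<delta>: "\<delta> \<ge> 0"
    "\<forall>w\<in>carrier G. \<forall>x\<in>carrier G. \<forall>y\<in>carrier G. \<forall>z\<in>carrier G.
      gromov_prod G S w x z \<ge> min (gromov_prod G S w x y) (gromov_prod G S w y z) - \<delta>"
    using hyp unfolding gromov_hyperbolic_def by (elim conjE exE) (rule that)
  interpret group G by fact
  interpret reflection_invariant_set G S m \<delta> F
  proof unfold_locales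
    show "carrier G = word_eval G ` lists S" by (fact m(1))
    show "word_eval G u = word_eval G v \<longleftrightarrow> cox_equiv S m u v" if "u \<in> lists S" "v \<in> lists S" for u v
      using m(2) that by simp
    show "min (gromov_prod G S w x y) (gromov_prod G S w y z) - \<delta> \<le> gromov_prod G S w x z"
      if "w \<in> carrier G" "x \<in> carrier G" "y \<in> carrier G" "z \<in> carrier G" for w x y z
      using \<delta>(2) that by simp
  qed (fact S \<delta>(1) F_sub two inv)+
  have "P = cut_group" unfolding P_def cut_group_eq ..
  then show ?thesis
    using parabolic_cut_group closure_eq_limit_set stab_eq_cut_group by (simp add: stab_def)
qed

end
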